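(* Let $r$ be the non-degenerate coalgebra automorphism of $D\otimes D$ described in the context, with parameters $\varepsilon,\alpha,\beta_a,\beta_b,\Gamma$. Then $r$ is a solution of the braid equation that induces $r_0$ on $X\times X$ and has set-type square up to height $1$ if and only if $(\varepsilon,\alpha,\beta_a,\beta_b,\Gamma)$ belongs to one of the following families: 1. $\varepsilon=1$, $\alpha=1$, $\beta_b=\beta_a$, with $\beta_a,\Gamma\in K$ (any characteristic); 2. $\varepsilon=1$, $\alpha=1$, $\Gamma=-\beta_a\beta_b$, with $\beta_a,\beta_b\in K$, $\beta_b\ne\beta_a$ (when $\operatorname{char}K\ne 2$); 3. $\varepsilon=1$, $\alpha=1$, with $\beta_a,\beta_b,\Gamma\in K$, $\beta_b\neq\beta_a$ (when $\operatorname{char}K=2$); 4. $\varepsilon=1$, $\alpha=-1$, $\beta_b=\beta_a$, with $\beta_a,\Gamma\in K$ (any characteristic); 5. $\varepsilon=1$, $\beta_b=\beta_a$, $\Gamma=-\frac{\beta_a^2}{\alpha}$, with $\beta_a\in K$, $\alpha\in K^\times$, $\alpha^2\ne1$ (any characteristic); 6. $\varepsilon=-1$, $\alpha=1$, $\beta_a=0$, with $\beta_b,\Gamma\in K$ (any characteristic); 7. $\varepsilon=-1$, $\alpha=-1$, $\beta_b=0$, with $\beta_a,\Gamma\in K$ (any characteristic); 8. $\varepsilon=-1$, $\beta_b=\beta_a\frac{1+\alpha}{1-\alpha}$, $\Gamma=-\frac{\beta_a^2(1+\alpha^2)}{\alpha(1-\alpha)^2}$, with $\beta_a\in K$, $\alpha\in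 K^\times$, $\alpha^2\ne1$ (any characteristic).
   Context: $u,v\in\mathbb N$ are coprime positive integers and $K$ is a field such that each element of $K^\times$ has $uv$ distinct $uv$-th roots in $K$. $X=\{a_0,\dots,a_{u-1},b_0,\dots,b_{v-1}\}$ ($u+v$ distinct elements) with the partial order whose only strict relations are $a_i<b_j$ for all $i,j$. Put $Y=\{(a,b)\in X\times X: a\le b\}$ and let $D=KY$ be the incidence coalgebra, with $\Delta(a,b)=\sum_{a\le c\le b}(a,c)\otimes(c,b)$, $\epsilon(a,b)=\delta_{ab}$. Tensor products are over $K$; each $x\in X$ is identified with $(x,x)\in D$. A coalgebra automorphism $r$ of $D\otimes D$ is non-degenerate if, with $\sigma=(\mathrm{id}\otimes\epsilon)\circ r$ and $\tau=(\epsilon\otimes\mathrm{id})\circ r$, the maps $(\mathrm{id}\otimes\sigma)\circ(\Delta\otimes\mathrm{id})$ and $(\tau\otimes\mathrm{id})\circ(\mathrm{id}\otimes\Delta)$ are isomorphisms. It is a solution of the braid equation if $r_{12}r_{23}r_{12}=r_{23}r_{12}r_{23}$ on $D^{\otimes3}$. $\phi_l,\phi_r\colon X\to X$ are commuting poset automorphisms and $r_0(x,y)=(\phi_l(y),\phi_r(x))$. Define permutations by $\phi_l(a_i)=a_{\sigma_a(i)}$, $\phi_l(b_j)=b_{\sigma_b(j)}$, $\phi_r(a_i)=a_{\tau_a(i)}$, $\phi_r(b_j)=b_{\tau_b(j)}$; it is assumed that $\sigma_a\circ\tau_a$ is a $u$-cycle on $\{0,\dots,u-1\}$ and $\sigma_b\circ\tau_b$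 is a $v$-cycle on $\{0,\dots,v-1\}$. Write ${}^{(1)}s=\phi_l(s)$, $s^{(1)}=\phi_r(s)$. $r$ is a non-degenerate coalgebra automorphism of $D\otimes D$ which induces $r_0$ on $X\times X$ (i.e. $r(x\otimes y)=\phi_l(y)\otimes\phi_r(x)$ for $x,y\in X$) and has set-type square up to height $1$, i.e. with $\varphi=\phi_l\circ\phi_r$, $r^2((a,b)\otimes(c,d))=(\varphi(a),\varphi(b))\otimes(\varphi(c),\varphi(d))$ for all $(a,b),(c,d)\in Y$ such that exactly one of the relations $a<b$, $c<d$ is strict and the other is an equality. Write $r((a,b)\otimes(c,d))=\sum_{e\le f}\sum_{g\le h}\lambda_{a|b|c|d}^{e|f|g|h}(e,f)\otimes(g,h)$. For $s\in X$ and $a<b$ set $\alpha_r(s)(a,b)=\lambda_{a|b|s|s}^{{}^{(1)}s|{}^{(1)}s|a^{(1)}|b^{(1)}}$, $\beta_r(s)(a,b)=\lambda_{a|b|s|s}^{{}^{(1)}s|{}^{(1)}s|a^{(1)}|a^{(1)}}$, $\alpha_l(s)(a,b)=\lambda_{s|s|a|b}^{{}^{(1)}a|{}^{(1)}b|s^{(1)}|s^{(1)}}$, $\beta_l(s)(a,b)=\lambda_{s|s|a|b}^{{}^{(1)}a|{}^{(1)}a|s^{(1)}|s^{(1)}}$, and $\Gamma_{i|j|k|l}=\lambda_{a_i|b_j|a_k|b_l}^{{}^{(1)}a_k|{}^{(1)}a_k|a_i^{(1)}|a_i^{(1)}}$. It is assumed that for each $f\in\{\alpha_l,\alpha_r,\beta_l,\beta_r\}$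 and all $i,j,k,m$ one has $f(a_i)(a_k,b_m)=f(a_0)(a_0,b_0)$ and $f(b_j)(a_k,b_m)=f(b_0)(a_0,b_0)$, and that $\Gamma_{i|j|k|l}=\Gamma:=\Gamma_{0|0|0|0}$ for all $i,j,k,l$ (conditions that every solution of the braid equation of this kind satisfies). Parameters: $\alpha=\alpha_l(a_0)(a_0,b_0)\in K^\times$, $\beta_a=\beta_l(a_0)(a_0,b_0)$, $\beta_b=\beta_l(b_0)(a_0,b_0)$, and $\varepsilon\in\{\pm1\}$ is determined by $\alpha_l(b_0)(a_0,b_0)=\varepsilon\alpha$ (such an $\varepsilon$ exists). *)

theory Defs
  imports "HOL-Analysis.Analysis" "HOL-Combinatorics.Orbits"
begin

section \<open>Tensor products of based spaces\<close>

text \<open>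
  A finite-dimensional \<open>K\<close>-vector space with basis indexed by a finite type \<open>'i\<close> is rendered as
  the library type \<open>'k ^ 'i\<close>, with basis vectors \<open>axis i 1\<close>. The tensor product of \<open>'k ^ 'i\<close> and
  \<open>'k ^ 'j\<close> is \<open>'k ^ ('i \<times> 'j)\<close>; the basis vector indexed by \<open>(i, j)\<close> is the tensor product of
  the basis vectors indexed by \<open>i\<close> and \<open>j\<close>.
\<close>

definition tens :: "'k::field ^ 'i \<Rightarrow> 'k ^ 'j \<Rightarrow> 'k ^ ('i::finite \<times> 'j::finite)"
    (infixr "\<otimes>\<^sub>v" 75)
  where "x \<otimes>\<^sub>v y = (\<chi> p. x $ fst p * y $ snd p)"

text \<open>The tensor product of two linear maps, defined through its values on the basis.\<close>

definition tens_map ::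
    "('k::field ^ 'i::finite \<Rightarrow> 'k ^ 'm::finite) \<Rightarrow> ('k ^ 'j::finite \<Rightarrow> 'k ^ 'n::finite)
      \<Rightarrow> 'k ^ ('i \<times> 'j) \<Rightarrow> 'k ^ ('m \<times> 'n)" (infixr "\<otimes>\<^sub>m" 75)
  where "(f \<otimes>\<^sub>m g) w =
    (\<Sum>i\<in>UNIV. \<Sum>j\<in>UNIV. (w $ (i, j)) *s (f (axis i 1) \<otimes>\<^sub>v g (axis j 1)))"

text \<open>
  \<open>id \<otimes> h\<close> and \<open>h \<otimes> id\<close> for a linear functional \<open>h\<close>, composed with the canonical identifications
  \<open>V \<otimes> K = V\<close> and \<open>K \<otimes> V = V\<close>.
\<close>

definition id_tens_functional ::
    "('k::field ^ 'j::finite \<Rightarrow> 'k) \<Rightarrow> 'k ^ ('i::finite \<times> 'j) \<Rightarrow> 'k ^ 'i"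
  where "id_tens_functional h w = (\<chi> i. h (\<chi> j. w $ (i, j)))"

definition functional_tens_id ::
    "('k::field ^ 'i::finite \<Rightarrow> 'k) \<Rightarrow> 'k ^ ('i \<times> 'j::finite) \<Rightarrow> 'k ^ 'j"
  where "functional_tens_id h w = (\<chi> j. h (\<chi> i. w $ (i, j)))"

definition assoc_r ::
    "'k::field ^ (('i::finite \<times> 'j::finite) \<times> 'l::finite) \<Rightarrow> 'k ^ ('i \<times> 'j \<times> 'l)"
  where "assoc_r w = vec_lambda (\<lambda>(i, j, l). w $ ((i, j), l))"

definition assoc_l ::
    "'k::field ^ ('i::finite \<times> 'j::finite \<times> 'l::finite) \<Rightarrow> 'k ^ (('i \<times> 'j) \<times> 'l)"
  where "assoc_l w = vec_lambda (\<lambda>((i, j), l). w $ (i, j, l))"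


section \<open>Coalgebra maps and the tensor product of coalgebras\<close>

definition coalgebra_hom ::
    "('k::field ^ 'i::finite \<Rightarrow> 'k ^ ('i \<times> 'i)) \<Rightarrow> ('k ^ 'i \<Rightarrow> 'k)
      \<Rightarrow> ('k ^ 'j::finite \<Rightarrow> 'k ^ ('j \<times> 'j)) \<Rightarrow> ('k ^ 'j \<Rightarrow> 'k)
      \<Rightarrow> ('k ^ 'i \<Rightarrow> 'k ^ 'j) \<Rightarrow> bool"
  where "coalgebra_hom \<Delta> \<epsilon> \<Delta>' \<epsilon>' f \<longleftrightarrow>
    Vector_Spaces.linear (*s) (*s) f \<and> \<Delta>' \<circ> f = (f \<otimes>\<^sub>m f) \<circ> \<Delta> \<and> \<epsilon>' \<circ> f = \<epsilon>"

definition coalgebra_aut ::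
    "('k::field ^ 'i::finite \<Rightarrow> 'k ^ ('i \<times> 'i)) \<Rightarrow> ('k ^ 'i \<Rightarrow> 'k)
      \<Rightarrow> ('k ^ 'i \<Rightarrow> 'k ^ 'i) \<Rightarrow> bool"
  where "coalgebra_aut \<Delta> \<epsilon> f \<longleftrightarrow> coalgebra_hom \<Delta> \<epsilon> \<Delta> \<epsilon> f \<and> bij f"

text \<open>
  The comultiplication of \<open>C \<otimes> C'\<close> is \<open>\<Delta> \<otimes> \<Delta>'\<close> followed by the exchange of the two middle
  tensor factors.
\<close>

definition tensor_comult ::
    "('k::field ^ 'i::finite \<Rightarrow> 'k ^ ('i \<times> 'i)) \<Rightarrow> ('k ^ 'j::finite \<Rightarrow> 'k ^ ('j \<times> 'j))
      \<Rightarrow> 'k ^ ('i \<times> 'j) \<Rightarrow> 'k ^ (('i \<times> 'j) \<times> ('i \<times> 'j))"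
  where "tensor_comult \<Delta> \<Delta>' w =
    vec_lambda (\<lambda>((i, j), (i', j')). (\<Delta> \<otimes>\<^sub>m \<Delta>') w $ ((i, i'), (j, j')))"

definition tensor_counit ::
    "('k::field ^ 'i::finite \<Rightarrow> 'k) \<Rightarrow> ('k ^ 'j::finite \<Rightarrow> 'k) \<Rightarrow> 'k ^ ('i \<times> 'j) \<Rightarrow> 'k"
  where "tensor_counit \<epsilon> \<epsilon>' w = \<epsilon> (id_tens_functional \<epsilon>' w)"


section \<open>The incidence coalgebra of a finite poset\<close>

typedef (overloaded) ('x::order) ivl = "{(x :: 'x, y). x \<le> y}"
  by auto

instance ivl :: ("{finite, order}") finite
proof
  have "(UNIV :: 'a ivl set) = range Abs_ivl"
    by (metis Rep_ivl_inverse surjI)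
  then show "finite (UNIV :: 'a ivl set)"
    by (metis finite finite_imageI)
qed

text \<open>\<open>Ivl x y\<close> is the element \<open>(x, y)\<close> of \<open>Y\<close>; it is meaningful only if \<open>x \<le> y\<close>.\<close>

definition Ivl :: "'x::order \<Rightarrow> 'x \<Rightarrow> 'x ivl"
  where "Ivl x y = Abs_ivl (x, y)"

definition lo :: "'x::order ivl \<Rightarrow> 'x"
  where "lo p = fst (Rep_ivl p)"

definition hi :: "'x::order ivl \<Rightarrow> 'x"
  where "hi p = snd (Rep_ivl p)"

lemma lo_Ivl [simp]: "x \<le> y \<Longrightarrow> lo (Ivl x y) = x"
  by (simp add: lo_def Ivl_def Abs_ivl_inverse)

lemma hi_Ivl [simp]: "x \<le> y \<Longrightarrow> hi (Ivl x y) = y"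
  by (simp add: hi_def Ivl_def Abs_ivl_inverse)

lemma lo_le_hi: "lo p \<le> hi p"
  using Rep_ivl[of p] by (auto simp: lo_def hi_def)

lemma Ivl_lo_hi [simp]: "Ivl (lo p) (hi p) = p"
  by (simp add: lo_def hi_def Ivl_def Rep_ivl_inverse)

definition bas :: "'x::{finite, order} \<Rightarrow> 'x \<Rightarrow> 'k::field ^ 'x ivl"
  where "bas x y = axis (Ivl x y) 1"

abbreviation pt :: "'x::{finite, order} \<Rightarrow> 'k::field ^ 'x ivl"
  where "pt x \<equiv> bas x x"

definition comult :: "'k::field ^ 'x::{finite, order} ivl \<Rightarrow> 'k ^ ('x ivl \<times> 'x ivl)"
  where "comult w =
    (\<Sum>p\<in>UNIV. (w $ p) *s (\<Sum>c\<in>{lo p..hi p}. bas (lo p) c \<otimes>\<^sub>v bas c (hi p)))"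

definition counit :: "'k::field ^ 'x::{finite, order} ivl \<Rightarrow> 'k"
  where "counit w = (\<Sum>p\<in>UNIV. w $ p * (if lo p = hi p then 1 else 0))"


section \<open>Endomorphisms of \<open>D \<otimes> D\<close>\<close>

type_synonym ('k, 'x) DD_endo = "'k ^ ('x ivl \<times> 'x ivl) \<Rightarrow> 'k ^ ('x ivl \<times> 'x ivl)"

definition DD_coalgebra_aut :: "('k::field, 'x::{finite, order}) DD_endo \<Rightarrow> bool"
  where "DD_coalgebra_aut r \<longleftrightarrow>
    coalgebra_aut (tensor_comult comult comult) (tensor_counit counit counit) r"

definition non_degenerate :: "('k::field, 'x::{finite, order}) DD_endo \<Rightarrow> bool"
  where "non_degenerate r \<longleftrightarrow>
    (let \<sigma> = id_tens_functional counit \<circ> r; \<tau> = functional_tens_id counit \<circ> r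
     in bij ((id \<otimes>\<^sub>m \<sigma>) \<circ> assoc_r \<circ> (comult \<otimes>\<^sub>m id)) \<and>
        bij ((\<tau> \<otimes>\<^sub>m id) \<circ> assoc_l \<circ> (id \<otimes>\<^sub>m comult)))"

text \<open>The triple tensor power of \<open>D\<close> is taken to be \<open>D \<otimes> (D \<otimes> D)\<close>.\<close>

definition braid_solution :: "('k::field, 'x::{finite, order}) DD_endo \<Rightarrow> bool"
  where "braid_solution r \<longleftrightarrow>
    (let r12 = assoc_r \<circ> (r \<otimes>\<^sub>m id) \<circ> assoc_l; r23 = id \<otimes>\<^sub>m r
     in r12 \<circ> r23 \<circ> r12 = r23 \<circ> r12 \<circ> r23)"

definition poset_aut :: "('x::order \<Rightarrow> 'x) \<Rightarrow> bool"
  where "poset_aut \<phi> \<longleftrightarrow> bij \<phi> \<and> (\<forall>x y. \<phi> x \<le> \<phi> y \<longleftrightarrow> x \<le> y)"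

definition induces ::
    "('x \<Rightarrow> 'x) \<Rightarrow> ('x \<Rightarrow> 'x) \<Rightarrow> ('k::field, 'x::{finite, order}) DD_endo \<Rightarrow> bool"
  where "induces \<phi>\<^sub>l \<phi>\<^sub>r r \<longleftrightarrow> (\<forall>x y. r (pt x \<otimes>\<^sub>v pt y) = pt (\<phi>\<^sub>l y) \<otimes>\<^sub>v pt (\<phi>\<^sub>r x))"

definition set_type_square_height1 ::
    "('x \<Rightarrow> 'x) \<Rightarrow> ('x \<Rightarrow> 'x) \<Rightarrow> ('k::field, 'x::{finite, order}) DD_endo \<Rightarrow> bool"
  where "set_type_square_height1 \<phi>\<^sub>l \<phi>\<^sub>r r \<longleftrightarrow>
    (let \<phi> = \<phi>\<^sub>l \<circ> \<phi>\<^sub>r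
     in \<forall>x y z w. (x < y \<and> z = w) \<or> (x = y \<and> z < w) \<longrightarrow>
          r (r (bas x y \<otimes>\<^sub>v bas z w)) = bas (\<phi> x) (\<phi> y) \<otimes>\<^sub>v bas (\<phi> z) (\<phi> w))"

text \<open>
  \<open>coeff r x y z w e f g h\<close> is the coefficient of \<open>(e, f) \<otimes> (g, h)\<close> in
  \<open>r ((x, y) \<otimes> (z, w))\<close>.
\<close>

definition coeff ::
    "('k::field, 'x::{finite, order}) DD_endo \<Rightarrow> 'x \<Rightarrow> 'x \<Rightarrow> 'x \<Rightarrow> 'x
      \<Rightarrow> 'x \<Rightarrow> 'x \<Rightarrow> 'x \<Rightarrow> 'x \<Rightarrow> 'k"
  where "coeff r x y z w e f g h = r (bas x y \<otimes>\<^sub>v bas z w) $ (Ivl e f, Ivl g h)"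

definition alpha_r ::
    "('x \<Rightarrow> 'x) \<Rightarrow> ('x \<Rightarrow> 'x) \<Rightarrow> ('k::field, 'x::{finite, order}) DD_endo
      \<Rightarrow> 'x \<Rightarrow> 'x \<Rightarrow> 'x \<Rightarrow> 'k"
  where "alpha_r \<phi>\<^sub>l \<phi>\<^sub>r r s x y = coeff r x y s s (\<phi>\<^sub>l s) (\<phi>\<^sub>l s) (\<phi>\<^sub>r x) (\<phi>\<^sub>r y)"

definition beta_r ::
    "('x \<Rightarrow> 'x) \<Rightarrow> ('x \<Rightarrow> 'x) \<Rightarrow> ('k::field, 'x::{finite, order}) DD_endo
      \<Rightarrow> 'x \<Rightarrow> 'x \<Rightarrow> 'x \<Rightarrow> 'k"
  where "beta_r \<phi>\<^sub>l \<phi>\<^sub>r r s x y = coeff r x y s s (\<phi>\<^sub>l s) (\<phi>\<^sub>l s) (\<phi>\<^sub>r x) (\<phi>\<^sub>r x)"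

definition alpha_l ::
    "('x \<Rightarrow> 'x) \<Rightarrow> ('x \<Rightarrow> 'x) \<Rightarrow> ('k::field, 'x::{finite, order}) DD_endo
      \<Rightarrow> 'x \<Rightarrow> 'x \<Rightarrow> 'x \<Rightarrow> 'k"
  where "alpha_l \<phi>\<^sub>l \<phi>\<^sub>r r s x y = coeff r s s x y (\<phi>\<^sub>l x) (\<phi>\<^sub>l y) (\<phi>\<^sub>r s) (\<phi>\<^sub>r s)"

definition beta_l ::
    "('x \<Rightarrow> 'x) \<Rightarrow> ('x \<Rightarrow> 'x) \<Rightarrow> ('k::field, 'x::{finite, order}) DD_endo
      \<Rightarrow> 'x \<Rightarrow> 'x \<Rightarrow> 'x \<Rightarrow> 'k"
  where "beta_l \<phi>\<^sub>l \<phi>\<^sub>r r s x y = coeff r s s x y (\<phi>\<^sub>l x) (\<phi>\<^sub>l x) (\<phi>\<^sub>r s) (\<phi>\<^sub>r s)"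

text \<open>The scalar \<open>\<Gamma>\<^bsub>i|j|k|l\<^esub>\<close> is \<open>Gamma4 \<phi>\<^sub>l \<phi>\<^sub>r r (a i) (b j) (a k) (b l)\<close>.\<close>

definition Gamma4 ::
    "('x \<Rightarrow> 'x) \<Rightarrow> ('x \<Rightarrow> 'x) \<Rightarrow> ('k::field, 'x::{finite, order}) DD_endo
      \<Rightarrow> 'x \<Rightarrow> 'x \<Rightarrow> 'x \<Rightarrow> 'x \<Rightarrow> 'k"
  where "Gamma4 \<phi>\<^sub>l \<phi>\<^sub>r r x y z w = coeff r x y z w (\<phi>\<^sub>l z) (\<phi>\<^sub>l z) (\<phi>\<^sub>r x) (\<phi>\<^sub>r x)"


section \<open>The poset \<open>{a\<^sub>0, \<dots>, b\<^sub>0, \<dots>}\<close>\<close>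

text \<open>The whole type \<open>'x\<close> is the poset \<open>X\<close>; only the values \<open>a i\<close> for \<open>i < u\<close> and \<open>b j\<close> for
  \<open>j < v\<close> matter.\<close>

definition bipartite_poset ::
    "nat \<Rightarrow> nat \<Rightarrow> (nat \<Rightarrow> 'x::{finite, order}) \<Rightarrow> (nat \<Rightarrow> 'x) \<Rightarrow> bool"
  where "bipartite_poset u v a b \<longleftrightarrow>
    inj_on a {..<u} \<and> inj_on b {..<v} \<and> a ` {..<u} \<inter> b ` {..<v} = {} \<and>
    (UNIV :: 'x set) = a ` {..<u} \<union> b ` {..<v} \<and>
    (\<forall>x y. x < y \<longleftrightarrow> (\<exists>i<u. \<exists>j<v. x = a i \<and> y = b j))"

end

theory Submission
  imports Defs
begin

text \<open>
  Every interval of the poset is a face (lower end, upper end, or the whole interval) of some pair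
  \<open>a\<^sub>i < b\<^sub>j\<close>, so all of \<open>D\<close> is covered by translates of the three-dimensional incidence coalgebra of
  a two-element chain. Comparing coefficients in \<open>\<Delta> \<circ> r = (r \<otimes> r) \<circ> \<Delta>\<close> expresses \<open>r\<close> on the faces of
  two strict intervals through \<open>\<alpha>\<close>, \<open>\<beta>\<close> and \<open>\<Gamma>\<close> alone, up to a translation by \<open>(\<phi>\<^sub>l, \<phi>\<^sub>r)\<close>; since
  \<open>\<phi>\<^sub>l\<close> and \<open>\<phi>\<^sub>r\<close> commute, the two sides of the braid equation are translated equally and the
  equation reduces to the one for the structure constants on the chain. Of its \<open>27 \<times> 27\<close> scalar
  components, three already force the parameters into the listed families, and for each family all
  components are ring identities.
\<close>

section \<open>Linear maps and comultiplications in coordinates\<close>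

lemma linear_eq_sum_axis:
  assumes "Vector_Spaces.linear (*s) (*s) f"
  shows "f w = (\<Sum>i\<in>UNIV. w $ i *s f (axis i 1))"
proof -
  interpret f: Vector_Spaces.linear "(*s)" "(*s)" f by fact
  have "f w = f (\<Sum>i\<in>UNIV. w $ i *s axis i 1)" by (simp add: basis_expansion)
  also have "\<dots> = (\<Sum>i\<in>UNIV. w $ i *s f (axis i 1))" by (simp add: f.sum f.scale)
  finally show ?thesis .
qed

lemma linear_eq_on_axis:
  assumes "Vector_Spaces.linear (*s) (*s) f" "Vector_Spaces.linear (*s) (*s) g"
    and "\<And>i. f (axis i 1) = g (axis i 1)"
  shows "f = g"
  by (rule ext) (subst linear_eq_sum_axis[OF assms(1)], subst linear_eq_sum_axis[OF assms(2)], simp only: assms(3))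

lemma linear_vecI:
  fixes f :: "'k::field ^ 'i \<Rightarrow> 'k ^ 'j"
  assumes "\<And>x y. f (x + y) = f x + f y" "\<And>c x. f (c *s x) = c *s f x"
  shows "Vector_Spaces.linear (*s) (*s) f"
  using assms by (simp add: Vector_Spaces.linear_iff vec.vector_space_axioms)

lemma tens_axis: "axis i 1 \<otimes>\<^sub>v axis j 1 = (axis (i, j) 1 :: 'k::field ^ _)"
  by (auto simp: tens_def axis_def vec_eq_iff)

lemma tens_map_nth:
  "(f \<otimes>\<^sub>m g) w $ (m, n) =
    (\<Sum>i\<in>UNIV. \<Sum>j\<in>UNIV. w $ (i, j) * (f (axis i 1) $ m * g (axis j 1) $ n))"
  by (simp add: tens_map_def tens_def)

lemma tens_map_axis: "(f \<otimes>\<^sub>m g) (axis (i, j) 1) = f (axis i 1) \<otimes>\<^sub>v g (axis j 1)"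
proof -
  have "(f \<otimes>\<^sub>m g) (axis (i, j) 1) =
    (\<Sum>i'\<in>UNIV. \<Sum>j'\<in>UNIV. if j' = j then if i' = i then f (axis i' 1) \<otimes>\<^sub>v g (axis j' 1) else 0 else 0)"
    unfolding tens_map_def by (intro sum.cong refl) (auto simp: axis_def)
  then show ?thesis by simp
qed

lemma linear_tens_map: "Vector_Spaces.linear (*s) (*s) (f \<otimes>\<^sub>m g)"
  by (rule linear_vecI)
    (simp_all add: tens_map_def vec.scale_left_distrib sum.distrib vec.scale_sum_right)

lemma linear_assoc_r: "Vector_Spaces.linear (*s) (*s) assoc_r"
  by (rule linear_vecI) (auto simp: assoc_r_def vec_eq_iff)

lemma linear_assoc_l: "Vector_Spaces.linear (*s) (*s) assoc_l"
  by (rule linear_vecI) (auto simp: assoc_l_def vec_eq_iff)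

lemma assoc_r_axis: "assoc_r (axis ((i, j), l) 1) = axis (i, j, l) 1"
  by (auto simp: assoc_r_def vec_eq_iff axis_def)

lemma assoc_l_axis: "assoc_l (axis (i, j, l) 1) = axis ((i, j), l) 1"
  by (auto simp: assoc_l_def vec_eq_iff axis_def)


section \<open>Cut points of intervals and the coproduct in coordinates\<close>

lemma ivl_eqI: "lo p = lo q \<Longrightarrow> hi p = hi q \<Longrightarrow> p = q"
  by (metis Ivl_lo_hi)

text \<open>A cut of \<open>p\<close> at \<open>c\<close> and a composable pair with concatenation
  \<open>p\<close> carry the same data: the pair returns the cut point as
  \<open>hi p1\<close>.\<close>

lemma ivl_glue_iff:
  "(c \<in> {lo p..hi p} \<and> Ivl (lo p) c = p1 \<and> Ivl c (hi p) = p2) \<longleftrightarrow>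
    (hi p1 = lo p2 \<and> Ivl (lo p1) (hi p2) = p \<and> c = hi p1)"
  using lo_le_hi[of p1] lo_le_hi[of p2]
  by (auto intro!: ivl_eqI dest: order.trans)

lemma sum_split_ivl:
  fixes p :: "'x::{finite, order} ivl"
  shows "(\<Sum>p1\<in>UNIV. \<Sum>p2\<in>UNIV. if hi p1 = lo p2 \<and> Ivl (lo p1) (hi p2) = p then G p1 p2 else 0) =
    (\<Sum>c\<in>{lo p..hi p}. G (Ivl (lo p) c) (Ivl c (hi p)))" (is "?L = _")
proof -
  define S where "S = {(p1, p2). hi p1 = lo p2 \<and> Ivl (lo p1) (hi p2) = p}"
  have S: "(p1, p2) \<in> S \<longleftrightarrow> hi p1 \<in> {lo p..hi p} \<and> Ivl (lo p) (hi p1) = p1 \<and> Ivl (hi p1) (hi p) = p2"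
    for p1 p2
    using ivl_glue_iff[of "hi p1" p p1 p2] by (simp add: S_def)
  have "?L = (\<Sum>(p1, p2)\<in>UNIV. if (p1, p2) \<in> S then G p1 p2 else 0)"
    by (simp add: sum.cartesian_product S_def)
  also have "\<dots> = (\<Sum>(p1, p2)\<in>S. G p1 p2)"
    by (rule sum.mono_neutral_cong_right) (auto split: if_splits)
  also have "\<dots> = (\<Sum>c\<in>{lo p..hi p}. G (Ivl (lo p) c) (Ivl c (hi p)))"
    by (rule sum.reindex_bij_witness[where i = "\<lambda>c. (Ivl (lo p) c, Ivl c (hi p))" and j = "hi \<circ> fst"])
      (auto simp: S)
  finally show ?thesis .
qed

lemma comult_nth:
  "comult w $ (p1, p2) = (if hi p1 = lo p2 then w $ Ivl (lo p1) (hi p2) else 0)"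
proof -
  let ?P = "\<lambda>p. hi p1 = lo p2 \<and> Ivl (lo p1) (hi p2) = p"
  have "(\<Sum>c\<in>{lo p..hi p}. (bas (lo p) c \<otimes>\<^sub>v bas c (hi p) :: 'a ^ _) $ (p1, p2)) = (if ?P p then 1 else 0)" for p
  proof -
    have "(\<Sum>c\<in>{lo p..hi p}. (bas (lo p) c \<otimes>\<^sub>v bas c (hi p) :: 'a ^ _) $ (p1, p2)) =
      (\<Sum>c\<in>{lo p..hi p}. if ?P p \<and> c = hi p1 then 1 else 0)"
    proof (intro sum.cong refl)
      fix c
      assume "c \<in> {lo p..hi p}"
      then have "(p1, p2) = (Ivl (lo p) c, Ivl c (hi p)) \<longleftrightarrow> ?P p \<and> c = hi p1"
        using ivl_glue_iff[of c p p1 p2] by (auto simp del: atLeastAtMost_iff)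
      then show "(bas (lo p) c \<otimes>\<^sub>v bas c (hi p) :: 'a ^ _) $ (p1, p2) = (if ?P p \<and> c = hi p1 then 1 else 0)"
        unfolding bas_def tens_axis by (simp only: axis_def vec_lambda_beta)
    qed
    then show ?thesis
      using ivl_glue_iff[of "hi p1" p p1 p2] by (cases "?P p") auto
  qed
  then have "comult w $ (p1, p2) = (\<Sum>p\<in>UNIV. w $ p * (if ?P p then 1 else 0))"
    by (simp add: comult_def)
  also have "\<dots> = (\<Sum>p\<in>UNIV. if Ivl (lo p1) (hi p2) = p then if hi p1 = lo p2 then w $ p else 0 else 0)"
    by (intro sum.cong refl) auto
  finally show ?thesis by simp
qed

lemma tensor_comult_nth:
  "tensor_comult comult comult w $ ((p1, q1), (p2, q2)) =
    (if hi p1 = lo p2 \<and> hi q1 = lo q2 then w $ (Ivl (lo p1) (hi p2), Ivl (lo q1) (hi q2)) else 0)"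
proof -
  have "tensor_comult comult comult w $ ((p1, q1), (p2, q2)) = (\<Sum>i\<in>UNIV. \<Sum>j\<in>UNIV.
      if j = Ivl (lo q1) (hi q2) then if i = Ivl (lo p1) (hi p2) then
        if hi p1 = lo p2 \<and> hi q1 = lo q2 then w $ (i, j) else 0 else 0 else 0)"
    unfolding tensor_comult_def
    unfolding vec_lambda_beta prod.case tens_map_nth comult_nth
    by (intro sum.cong refl) (simp add: axis_def)
  then show ?thesis by simp
qed

text \<open>The left side is a coefficient of the coproduct after \<open>r\<close>, the right side
  the same coefficient of \<open>r \<otimes>\<^sub>m r\<close> after the coproduct, with one summand
  for each way to cut both intervals.\<close>

lemma DD_coalgebra_aut_nth:
  assumes "DD_coalgebra_aut r"
  shows "(if hi p1 = lo p2 \<and> hi q1 = lo q2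
      then r (axis (p, q) 1) $ (Ivl (lo p1) (hi p2), Ivl (lo q1) (hi q2)) else 0) =
    (\<Sum>c\<in>{lo p..hi p}. \<Sum>d\<in>{lo q..hi q}.
      r (axis (Ivl (lo p) c, Ivl (lo q) d) 1) $ (p1, q1) *
      r (axis (Ivl c (hi p), Ivl d (hi q)) 1) $ (p2, q2))"
proof -
  let ?T = "tensor_comult comult comult"
  let ?m = "\<lambda>p1 p2 p. hi p1 = lo p2 \<and> Ivl (lo p1) (hi p2) = p"
  let ?r = "\<lambda>I J. r (axis I 1) $ J"
  have "?T \<circ> r = (r \<otimes>\<^sub>m r) \<circ> ?T"
    using assms by (simp add: DD_coalgebra_aut_def coalgebra_aut_def coalgebra_hom_def)
  then have "?T (r (axis (p, q) 1)) $ ((p1, q1), (p2, q2)) =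
      (r \<otimes>\<^sub>m r) (?T (axis (p, q) 1)) $ ((p1, q1), (p2, q2))"
    by (simp add: fun_eq_iff)
  also have "\<dots> = (\<Sum>(x1, y1)\<in>UNIV. \<Sum>(x2, y2)\<in>UNIV.
      if ?m x1 x2 p then if ?m y1 y2 q then ?r (x1, y1) (p1, q1) * ?r (x2, y2) (p2, q2) else 0 else 0)"
    unfolding tens_map_nth
    by (intro sum.cong refl) (auto simp: tensor_comult_nth axis_def intro!: sum.cong)
  also have "\<dots> = (\<Sum>x1\<in>UNIV. \<Sum>y1\<in>UNIV. \<Sum>x2\<in>UNIV. \<Sum>y2\<in>UNIV.
      if ?m x1 x2 p then if ?m y1 y2 q then ?r (x1, y1) (p1, q1) * ?r (x2, y2) (p2, q2) else 0 else 0)"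
    by (simp flip: UNIV_Times_UNIV sum.cartesian_product)
  \<comment> \<open>The two halves of \<open>p\<close> are made adjacent, and likewise those of
    \<open>q\<close>, so that \<open>sum_split_ivl\<close> applies to each pair.\<close>
  also have "\<dots> = (\<Sum>x1\<in>UNIV. \<Sum>x2\<in>UNIV. \<Sum>y1\<in>UNIV. \<Sum>y2\<in>UNIV.
      if ?m x1 x2 p then if ?m y1 y2 q then ?r (x1, y1) (p1, q1) * ?r (x2, y2) (p2, q2) else 0 else 0)"
    by (intro sum.cong refl sum.swap)
  also have "\<dots> = (\<Sum>x1\<in>UNIV. \<Sum>x2\<in>UNIV. if ?m x1 x2 p then
      (\<Sum>y1\<in>UNIV. \<Sum>y2\<in>UNIV. if ?m y1 y2 q then ?r (x1, y1) (p1, q1) * ?r (x2, y2) (p2, q2) else 0) else 0)"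
    by (intro sum.cong refl) auto
  also have "\<dots> = (\<Sum>c\<in>{lo p..hi p}. \<Sum>d\<in>{lo q..hi q}.
      ?r (Ivl (lo p) c, Ivl (lo q) d) (p1, q1) * ?r (Ivl c (hi p), Ivl d (hi q)) (p2, q2))"
    by (subst sum_split_ivl) (simp only: sum_split_ivl)
  finally show ?thesis by (simp add: tensor_comult_nth)
qed

section \<open>The flip on faces of strict intervals\<close>

text \<open>Labels for the basis of the incidence coalgebra of a two-element chain. The same labels
  serve every strict interval, which makes coefficients at different intervals comparable.\<close>

datatype cell = Lo | Hi | Full

lemma UNIV_cell: "UNIV = {Lo, Hi, Full}"
  using cell.exhaust by auto

instance cell :: finite
  by standard (simp add: UNIV_cell)

lemma sum_cell: "(\<Sum>x\<in>UNIV. f x) = f Lo + f Hi + f Full"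
  by (simp add: UNIV_cell add.assoc)

fun face :: "cell \<Rightarrow> 'x::order ivl \<Rightarrow> 'x ivl" where
  "face Lo p = Ivl (lo p) (lo p)"
| "face Hi p = Ivl (hi p) (hi p)"
| "face Full p = p"

lemma face_eq_iff:
  assumes "lo p < hi p"
  shows "face x p = face y p \<longleftrightarrow> x = y"
proof
  assume "face x p = face y p"
  then have "lo (face x p) = lo (face y p)" "hi (face x p) = hi (face y p)"
    by simp_all
  with assms show "x = y"
    by (cases x; cases y) auto
qed simp

definition map_ivl :: "('x \<Rightarrow> 'x) \<Rightarrow> 'x::order ivl \<Rightarrow> 'x ivl"
  where "map_ivl \<phi> p = Ivl (\<phi> (lo p)) (\<phi> (hi p))"

lemma lo_map_ivl [simp]: "poset_aut \<phi> \<Longrightarrow> lo (map_ivl \<phi> p) = \<phi> (lo p)"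
  and hi_map_ivl [simp]: "poset_aut \<phi> \<Longrightarrow> hi (map_ivl \<phi> p) = \<phi> (hi p)"
  by (simp_all add: map_ivl_def poset_aut_def lo_le_hi)

lemma poset_aut_less: "poset_aut \<phi> \<Longrightarrow> \<phi> x < \<phi> y \<longleftrightarrow> x < y"
  by (auto simp: poset_aut_def less_le_not_le)

lemma axis_1_nth: "axis i 1 $ j = (if j = i then 1 else 0)"
  by (simp add: axis_def)

text \<open>Strictness makes the nine products of faces distinct basis vectors, so a vector
  supported on them is the sum of its nine components.\<close>

lemma vec_eq_sum_faces:
  fixes w :: "'k::field ^ ('x::{finite, order} ivl \<times> 'x ivl)"
  assumes "lo p < hi p" "lo q < hi q"
    and c: "\<And>x y. w $ (face x p, face y q) = c x y"
    and supp: "\<And>p' q'. w $ (p', q') \<noteq> 0 \<Longrightarrow> \<exists>x y. p' = face x p \<and> q' = face y q"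
  shows "w = (\<Sum>x\<in>UNIV. \<Sum>y\<in>UNIV. c x y *s axis (face x p, face y q) 1)"
proof (clarsimp simp: vec_eq_iff)
  fix p' q'
  show "w $ (p', q') = (\<Sum>x\<in>UNIV. \<Sum>y\<in>UNIV. c x y * axis (face x p, face y q) 1 $ (p', q'))"
  proof (cases "\<exists>x y. p' = face x p \<and> q' = face y q")
    case True
    then obtain x y where xy: "p' = face x p" "q' = face y q" by blast
    have "(\<Sum>x'\<in>UNIV. \<Sum>y'\<in>UNIV. c x' y' * axis (face x' p, face y' q) 1 $ (p', q')) =
        (\<Sum>x'\<in>UNIV. \<Sum>y'\<in>UNIV. if y' = y then if x' = x then c x' y' else 0 else 0)"
      by (intro sum.cong refl) (auto simp: xy axis_1_nth face_eq_iff[OF assms(1)] face_eq_iff[OF assms(2)])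
    then show ?thesis by (simp add: xy c)
  next
    case False
    then have "w $ (p', q') = 0" using supp by blast
    moreover have "(\<Sum>x\<in>UNIV. \<Sum>y\<in>UNIV. c x y * axis (face x p, face y q) 1 $ (p', q')) = 0"
      using False by (intro sum.neutral ballI) (auto simp: axis_1_nth)
    ultimately show ?thesis by simp
  qed
qed

text \<open>The hypothesis \<open>f\<close> says that the vector w with coefficients
  \<open>f\<close> is skew-primitive: \<Delta> w = g \<otimes> w + w \<otimes> h for the grouplike
  elements g and h given by \<open>(g1, g2)\<close> and \<open>(h1, h2)\<close>. Cutting off lower
  and upper ends confines its support.\<close>

lemma skew_primitive_support:
  fixes f :: "'x::order ivl \<Rightarrow> 'x ivl \<Rightarrow> 'k::field"
  assumes neq: "(g1, g2) \<noteq> (h1, h2)"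
    and f: "\<And>p1 q1 p2 q2.
      (if hi p1 = lo p2 \<and> hi q1 = lo q2 then f (Ivl (lo p1) (hi p2)) (Ivl (lo q1) (hi q2)) else 0) =
      (if p1 = Ivl g1 g1 \<and> q1 = Ivl g2 g2 then f p2 q2 else 0) +
      (if p2 = Ivl h1 h1 \<and> q2 = Ivl h2 h2 then f p1 q1 else 0)"
  shows "f (Ivl h1 h1) (Ivl h2 h2) = - f (Ivl g1 g1) (Ivl g2 g2)"
    and "f p q \<noteq> 0 \<Longrightarrow> p = Ivl g1 g1 \<and> q = Ivl g2 g2 \<or> p = Ivl h1 h1 \<and> q = Ivl h2 h2 \<or>
      p = Ivl g1 h1 \<and> q = Ivl g2 h2"
proof -
  \<comment> \<open>The coefficient at g \<otimes> h vanishes on the left, since distinct points are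
    not composable.\<close>
  show "f (Ivl h1 h1) (Ivl h2 h2) = - f (Ivl g1 g1) (Ivl g2 g2)"
    using f[of "Ivl g1 g1" "Ivl h1 h1" "Ivl g2 g2" "Ivl h2 h2"] neq
    by (simp add: eq_neg_iff_add_eq_0 split: if_splits)
  have pt: "Ivl x x = Ivl y y \<longleftrightarrow> x = y" for x y :: 'x
    by (metis lo_Ivl order.refl)
  assume nz: "f p q \<noteq> 0"
  \<comment> \<open>Cutting at the lower ends leaves \<open>f p q\<close> itself on the left, so a
    summand on the right is nonzero; \<open>2\<close> repeats this at the upper ends.\<close>
  have 1: "lo p = g1 \<and> lo q = g2 \<or> p = Ivl h1 h1 \<and> q = Ivl h2 h2"
    using f[of "face Lo p" p "face Lo q" q] nz by (auto simp: pt split: if_splits)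
  have 2: "hi p = h1 \<and> hi q = h2 \<or> p = Ivl g1 g1 \<and> q = Ivl g2 g2"
    using f[of p "face Hi p" q "face Hi q"] nz by (auto simp: pt split: if_splits)
  show "p = Ivl g1 g1 \<and> q = Ivl g2 g2 \<or> p = Ivl h1 h1 \<and> q = Ivl h2 h2 \<or>
      p = Ivl g1 h1 \<and> q = Ivl g2 h2"
    using 1 2 by (metis Ivl_lo_hi)
qed

text \<open>
  \<open>L s x\<close> and \<open>R t y\<close> are the coefficients of \<open>r\<close> on (end \<open>s\<close>) \<open>\<otimes>\<close> (strict interval) and on
  (strict interval) \<open>\<otimes>\<close> (end \<open>t\<close>). For two strict intervals the square
  \<open>[lo, hi] \<times> [lo, hi]\<close> splits along either of its sides, which yields all coefficients except
  the free one \<open>\<Gamma>\<close>.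
\<close>

fun full_coeff :: "(cell \<Rightarrow> cell \<Rightarrow> 'k::field) \<Rightarrow> (cell \<Rightarrow> cell \<Rightarrow> 'k) \<Rightarrow> 'k \<Rightarrow> cell \<Rightarrow> cell \<Rightarrow> 'k" where
  "full_coeff L R \<Gamma> Full Full = L Lo Full * R Hi Full"
| "full_coeff L R \<Gamma> Full Lo = L Lo Full * R Hi Lo"
| "full_coeff L R \<Gamma> Full Hi = R Lo Hi * L Hi Full"
| "full_coeff L R \<Gamma> Lo Full = R Lo Full * L Hi Lo"
| "full_coeff L R \<Gamma> Hi Full = L Lo Hi * R Hi Full"
| "full_coeff L R \<Gamma> Lo Lo = \<Gamma>"
| "full_coeff L R \<Gamma> Lo Hi = R Lo Hi * L Hi Lo"
| "full_coeff L R \<Gamma> Hi Lo = L Lo Hi * R Hi Lo"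
| "full_coeff L R \<Gamma> Hi Hi = - \<Gamma> - L Lo Lo * R Hi Hi - R Lo Lo * L Hi Hi"

text \<open>The factors are exchanged by \<open>r\<close>: an end \<open>t\<close> in second place
  reappears as first output, an end \<open>s\<close> in first place as second output.\<close>

definition cell_coeff ::
    "(cell \<Rightarrow> cell \<Rightarrow> 'k::field) \<Rightarrow> (cell \<Rightarrow> cell \<Rightarrow> 'k) \<Rightarrow> 'k \<Rightarrow> cell \<Rightarrow> cell \<Rightarrow> cell \<Rightarrow> cell \<Rightarrow> 'k"
  where "cell_coeff L R \<Gamma> s t x y =
    (if s = Full then
       if t = Full then full_coeff L R \<Gamma> x y else if x = t then R t y else 0
     else if t = Full then if y = s then L s x else 0
     else if x = t \<and> y = s then 1 else 0)"

text \<open>The coefficient conditions express that \<open>r\<close> looks the same at all strict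
  intervals. They omit \<open>Hi\<close>, whose coefficient is forced by skew-primitivity;
  \<open>L_Hi\<close> and \<open>R_Hi\<close> fix the matching values of \<open>L\<close> and
  \<open>R\<close>. By \<open>thin\<close> a strict interval has only two cut points.\<close>

locale height_one_flip =
  fixes \<phi>\<^sub>l \<phi>\<^sub>r :: "'x::{finite, order} \<Rightarrow> 'x"
    and r :: "('k::field, 'x) DD_endo"
    and L R :: "cell \<Rightarrow> cell \<Rightarrow> 'k" and \<Gamma> :: 'k
  assumes coalg: "DD_coalgebra_aut r"
    and aut: "poset_aut \<phi>\<^sub>l" "poset_aut \<phi>\<^sub>r"
    and flip: "induces \<phi>\<^sub>l \<phi>\<^sub>r r"
    and thin: "\<And>x y :: 'x. x < y \<Longrightarrow> {x..y} = {x, y}"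
    and coeff_L: "\<And>s x p q. s \<noteq> Full \<Longrightarrow> x \<noteq> Hi \<Longrightarrow> lo p < hi p \<Longrightarrow> lo q < hi q \<Longrightarrow>
      r (axis (face s p, q) 1) $ (face x (map_ivl \<phi>\<^sub>l q), face s (map_ivl \<phi>\<^sub>r p)) = L s x"
    and coeff_R: "\<And>t y p q. t \<noteq> Full \<Longrightarrow> y \<noteq> Hi \<Longrightarrow> lo p < hi p \<Longrightarrow> lo q < hi q \<Longrightarrow>
      r (axis (p, face t q) 1) $ (face t (map_ivl \<phi>\<^sub>l q), face y (map_ivl \<phi>\<^sub>r p)) = R t y"
    and coeff_\<Gamma>: "\<And>p q. lo p < hi p \<Longrightarrow> lo q < hi q \<Longrightarrow>
      r (axis (p, q) 1) $ (face Lo (map_ivl \<phi>\<^sub>l q), face Lo (map_ivl \<phi>\<^sub>r p)) = \<Gamma>"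
    and L_Hi: "\<And>s. L s Hi = - L s Lo"
    and R_Hi: "\<And>t. R t Hi = - R t Lo"
begin

section \<open>Coefficients of \<open>r\<close> on products of faces\<close>

abbreviation "Yl \<equiv> map_ivl \<phi>\<^sub>l"
abbreviation "Yr \<equiv> map_ivl \<phi>\<^sub>r"
abbreviation "cc \<equiv> cell_coeff L R \<Gamma>"

lemma strict_map: "lo p < hi p \<Longrightarrow> lo (Yl p) < hi (Yl p)" "lo p < hi p \<Longrightarrow> lo (Yr p) < hi (Yr p)"
  by (simp_all add: aut poset_aut_less)

lemma r_point: "r (axis (Ivl x x, Ivl y y) 1) = axis (Ivl (\<phi>\<^sub>l y) (\<phi>\<^sub>l y), Ivl (\<phi>\<^sub>r x) (\<phi>\<^sub>r x)) 1"
  using flip by (simp add: induces_def bas_def tens_axis)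

text \<open>The coproduct of (end) \<otimes> (strict interval) has two terms, each with a grouplike
  factor, so its image under \<open>r\<close> is skew-primitive. The two grouplikes of the image
  agree in the second component, which pins the second output to
  \<open>face s (Yr p)\<close>.\<close>

lemma r_point_full:
  assumes "s \<noteq> Full" "lo p < hi p" "lo q < hi q"
  shows "r (axis (face s p, q) 1) $ (face x (Yl q), face y (Yr p)) = cc s Full x y"
    and "r (axis (face s p, q) 1) $ (p', q') \<noteq> 0 \<Longrightarrow> \<exists>x y. p' = face x (Yl q) \<and> q' = face y (Yr p)"
proof -
  define f where "f p' q' = r (axis (face s p, q) 1) $ (p', q')" for p' q'
  obtain z where z: "face s p = Ivl z z" "face s (Yr p) = Ivl (\<phi>\<^sub>r z) (\<phi>\<^sub>r z)"
    using assms(1) aut by (cases s) auto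
  have split: "(if hi p1 = lo p2 \<and> hi q1 = lo q2 then f (Ivl (lo p1) (hi p2)) (Ivl (lo q1) (hi q2)) else 0) =
      (if p1 = Ivl (\<phi>\<^sub>l (lo q)) (\<phi>\<^sub>l (lo q)) \<and> q1 = Ivl (\<phi>\<^sub>r z) (\<phi>\<^sub>r z) then f p2 q2 else 0) +
      (if p2 = Ivl (\<phi>\<^sub>l (hi q)) (\<phi>\<^sub>l (hi q)) \<and> q2 = Ivl (\<phi>\<^sub>r z) (\<phi>\<^sub>r z) then f p1 q1 else 0)" for p1 q1 p2 q2
    unfolding f_def
    by (subst DD_coalgebra_aut_nth[OF coalg]) (use assms in \<open>auto simp: z thin r_point axis_1_nth\<close>)
  have neq: "(\<phi>\<^sub>l (lo q), \<phi>\<^sub>r z) \<noteq> (\<phi>\<^sub>l (hi q), \<phi>\<^sub>r z)"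
    using assms(3) poset_aut_less[OF aut(1), of "lo q" "hi q"] by auto
  note sp = skew_primitive_support[OF neq split]
  have faces: "face Lo (Yl q) = Ivl (\<phi>\<^sub>l (lo q)) (\<phi>\<^sub>l (lo q))" "face Hi (Yl q) = Ivl (\<phi>\<^sub>l (hi q)) (\<phi>\<^sub>l (hi q))"
    "face Full (Yl q) = Ivl (\<phi>\<^sub>l (lo q)) (\<phi>\<^sub>l (hi q))"
    by (simp_all add: aut) (simp add: map_ivl_def)
  have supp: "f p' q' \<noteq> 0 \<Longrightarrow> (\<exists>x. p' = face x (Yl q)) \<and> q' = face s (Yr p)" for p' q'
    using sp(2)[of p' q'] unfolding faces[symmetric] z(2) by blast
  show "r (axis (face s p, q) 1) $ (p', q') \<noteq> 0 \<Longrightarrow> \<exists>x y. p' = face x (Yl q) \<and> q' = face y (Yr p)"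
    using supp[of p' q'] by (auto simp: f_def)
  show "r (axis (face s p, q) 1) $ (face x (Yl q), face y (Yr p)) = cc s Full x y"
  proof (cases "y = s")
    case True
    have "f (face Hi (Yl q)) (face s (Yr p)) = - f (face Lo (Yl q)) (face s (Yr p))"
      using sp(1) by (simp only: faces z(2))
    then show ?thesis
      using True assms coeff_L[of s x p q] coeff_L[of s Lo p q]
      by (cases "x = Hi") (simp_all add: f_def cell_coeff_def L_Hi del: face.simps)
  next
    case False
    then show ?thesis
      using supp[of "face x (Yl q)" "face y (Yr p)"] assms
      by (auto simp: f_def cell_coeff_def face_eq_iff strict_map)
  qed
qed

text \<open>Symmetric to \<open>r_point_full\<close>: now the first output is pinned to
  \<open>face t (Yl q)\<close>.\<close>

lemma r_full_point:
  assumes "t \<noteq> Full" "lo p < hi p" "lo q < hi q"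
  shows "r (axis (p, face t q) 1) $ (face x (Yl q), face y (Yr p)) = cc Full t x y"
    and "r (axis (p, face t q) 1) $ (p', q') \<noteq> 0 \<Longrightarrow> \<exists>x y. p' = face x (Yl q) \<and> q' = face y (Yr p)"
proof -
  define f where "f p' q' = r (axis (p, face t q) 1) $ (p', q')" for p' q'
  obtain z where z: "face t q = Ivl z z" "face t (Yl q) = Ivl (\<phi>\<^sub>l z) (\<phi>\<^sub>l z)"
    using assms(1) aut by (cases t) auto
  have split: "(if hi p1 = lo p2 \<and> hi q1 = lo q2 then f (Ivl (lo p1) (hi p2)) (Ivl (lo q1) (hi q2)) else 0) =
      (if p1 = Ivl (\<phi>\<^sub>l z) (\<phi>\<^sub>l z) \<and> q1 = Ivl (\<phi>\<^sub>r (lo p)) (\<phi>\<^sub>r (lo p)) then f p2 q2 else 0) +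
      (if p2 = Ivl (\<phi>\<^sub>l z) (\<phi>\<^sub>l z) \<and> q2 = Ivl (\<phi>\<^sub>r (hi p)) (\<phi>\<^sub>r (hi p)) then f p1 q1 else 0)" for p1 q1 p2 q2
    unfolding f_def
    by (subst DD_coalgebra_aut_nth[OF coalg]) (use assms in \<open>auto simp: z thin r_point axis_1_nth\<close>)
  have neq: "(\<phi>\<^sub>l z, \<phi>\<^sub>r (lo p)) \<noteq> (\<phi>\<^sub>l z, \<phi>\<^sub>r (hi p))"
    using assms(2) poset_aut_less[OF aut(2), of "lo p" "hi p"] by auto
  note sp = skew_primitive_support[OF neq split]
  have faces: "face Lo (Yr p) = Ivl (\<phi>\<^sub>r (lo p)) (\<phi>\<^sub>r (lo p))" "face Hi (Yr p) = Ivl (\<phi>\<^sub>r (hi p)) (\<phi>\<^sub>r (hi p))"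
    "face Full (Yr p) = Ivl (\<phi>\<^sub>r (lo p)) (\<phi>\<^sub>r (hi p))"
    by (simp_all add: aut) (simp add: map_ivl_def)
  have supp: "f p' q' \<noteq> 0 \<Longrightarrow> p' = face t (Yl q) \<and> (\<exists>y. q' = face y (Yr p))" for p' q'
    using sp(2)[of p' q'] unfolding faces[symmetric] z(2) by blast
  show "r (axis (p, face t q) 1) $ (p', q') \<noteq> 0 \<Longrightarrow> \<exists>x y. p' = face x (Yl q) \<and> q' = face y (Yr p)"
    using supp[of p' q'] by (auto simp: f_def)
  show "r (axis (p, face t q) 1) $ (face x (Yl q), face y (Yr p)) = cc Full t x y"
  proof (cases "x = t")
    case True
    have "f (face t (Yl q)) (face Hi (Yr p)) = - f (face t (Yl q)) (face Lo (Yr p))"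
      using sp(1) by (simp only: faces z(2))
    then show ?thesis
      using True assms coeff_R[of t y p q] coeff_R[of t Lo p q]
      by (cases "y = Hi") (simp_all add: f_def cell_coeff_def R_Hi del: face.simps)
  next
    case False
    then show ?thesis
      using supp[of "face x (Yl q)" "face y (Yr p)"] assms
      by (auto simp: f_def cell_coeff_def face_eq_iff strict_map)
  qed
qed

text \<open>The coproduct of a product of two strict intervals has four terms: two contain the
  product itself next to a grouplike, and two are mixed terms whose images are known. This
  determines all coefficients from the one at (\<open>Lo\<close>, \<open>Lo\<close>).\<close>

lemma r_full_full:
  assumes "lo p < hi p" "lo q < hi q"
  shows "r (axis (p, q) 1) $ (face x (Yl q), face y (Yr p)) = cc Full Full x y"
    and "r (axis (p, q) 1) $ (p', q') \<noteq> 0 \<Longrightarrow> \<exists>x y. p' = face x (Yl q) \<and> q' = face y (Yr p)"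
proof -
  define f where "f s t p' q' = r (axis (face s p, face t q) 1) $ (p', q')" for s t p' q'
  have f_pt: "f s t p' q' = (if p' = face t (Yl q) \<and> q' = face s (Yr p) then 1 else 0)"
    if "s \<noteq> Full" "t \<noteq> Full" for s t p' q'
    using that by (cases s; cases t) (auto simp: f_def r_point axis_1_nth aut)
  have split: "(if hi p1 = lo p2 \<and> hi q1 = lo q2 then f Full Full (Ivl (lo p1) (hi p2)) (Ivl (lo q1) (hi q2)) else 0) =
      (if p1 = face Lo (Yl q) \<and> q1 = face Lo (Yr p) then f Full Full p2 q2 else 0)
      + f Lo Full p1 q1 * f Full Hi p2 q2 + f Full Lo p1 q1 * f Hi Full p2 q2
      + (if p2 = face Hi (Yl q) \<and> q2 = face Hi (Yr p) then f Full Full p1 q1 else 0)" for p1 q1 p2 q2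
  proof -
    have "lo p \<noteq> hi p" "lo q \<noteq> hi q" using assms by auto
    then have "(if hi p1 = lo p2 \<and> hi q1 = lo q2 then f Full Full (Ivl (lo p1) (hi p2)) (Ivl (lo q1) (hi q2)) else 0) =
      f Lo Lo p1 q1 * f Full Full p2 q2 + f Lo Full p1 q1 * f Full Hi p2 q2
      + f Full Lo p1 q1 * f Hi Full p2 q2 + f Full Full p1 q1 * f Hi Hi p2 q2"
      unfolding f_def face.simps
      by (subst DD_coalgebra_aut_nth[OF coalg]) (use assms in \<open>simp add: thin algebra_simps\<close>)
    then show ?thesis
      by (simp add: f_pt del: face.simps)
  qed
  have f1: "f Lo Full (face x (Yl q)) (face y (Yr p)) = cc Lo Full x y"
    "f Hi Full (face x (Yl q)) (face y (Yr p)) = cc Hi Full x y"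
    "f Full Lo (face x (Yl q)) (face y (Yr p)) = cc Full Lo x y"
    "f Full Hi (face x (Yl q)) (face y (Yr p)) = cc Full Hi x y" for x y
    using r_point_full(1)[of Lo p q x y] r_point_full(1)[of Hi p q x y]
      r_full_point(1)[of Lo p q x y] r_full_point(1)[of Hi p q x y] assms
    by (simp_all add: f_def)
  have f2: "f Lo Full p' q' \<noteq> 0 \<or> f Hi Full p' q' \<noteq> 0 \<or> f Full Lo p' q' \<noteq> 0 \<or> f Full Hi p' q' \<noteq> 0 \<Longrightarrow>
    \<exists>x y. p' = face x (Yl q) \<and> q' = face y (Yr p)" for p' q'
    using r_point_full(2)[of Lo p q p' q'] r_point_full(2)[of Hi p q p' q']
      r_full_point(2)[of Lo p q p' q'] r_full_point(2)[of Hi p q p' q'] assms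
    by (auto simp: f_def)
  have neq: "\<phi>\<^sub>l (lo q) \<noteq> \<phi>\<^sub>l (hi q)" "\<phi>\<^sub>r (lo p) \<noteq> \<phi>\<^sub>r (hi p)"
    using strict_map assms aut by (metis hi_map_ivl lo_map_ivl less_irrefl)+
  have face_iff: "face x (Yl q) = face y (Yl q) \<longleftrightarrow> x = y" "face x (Yr p) = face y (Yr p) \<longleftrightarrow> x = y" for x y
    using assms by (simp_all add: face_eq_iff strict_map)
  have lo_hi_face: "lo (face x p) = (if x = Hi then hi p else lo p)"
    "hi (face x p) = (if x = Lo then lo p else hi p)" for x and p :: "'x ivl"
    by (cases x; simp)+
  have glue: "Ivl (lo p) (lo p) = face Lo p" "Ivl (hi p) (hi p) = face Hi p"
    for p :: "'x ivl"
    by simp_all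
  have comp: "(if hi (face x1 (Yl q)) = lo (face x2 (Yl q)) \<and> hi (face y1 (Yr p)) = lo (face y2 (Yr p))
      then f Full Full (Ivl (lo (face x1 (Yl q))) (hi (face x2 (Yl q)))) (Ivl (lo (face y1 (Yr p))) (hi (face y2 (Yr p)))) else 0) =
      (if x1 = Lo \<and> y1 = Lo then f Full Full (face x2 (Yl q)) (face y2 (Yr p)) else 0)
      + cc Lo Full x1 y1 * cc Full Hi x2 y2 + cc Full Lo x1 y1 * cc Hi Full x2 y2
      + (if x2 = Hi \<and> y2 = Hi then f Full Full (face x1 (Yl q)) (face y1 (Yr p)) else 0)" for x1 x2 y1 y2
    by (subst split) (simp only: f1 face_iff)
  note eval = lo_hi_face glue cell_coeff_def
  have "f Full Full (face x (Yl q)) (face y (Yr p)) = cc Full Full x y"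
  \<comment> \<open>Apart from the corners (\<open>Lo\<close>, \<open>Lo\<close>) and
    (\<open>Hi\<close>, \<open>Hi\<close>), the faces are cut so that both summands of
    \<open>comp\<close> with unknown coefficients drop out and only products of known ones
    remain.\<close>
  proof (cases x; cases y)
    assume "x = Lo" "y = Lo"
    then show ?thesis using coeff_\<Gamma>[OF assms] by (simp add: f_def cell_coeff_def)
  next
    assume "x = Lo" "y = Hi"
    then show ?thesis using comp[of Lo Lo Hi Hi] by (simp add: eval del: face.simps(1,2))
  next
    assume "x = Lo" "y = Full"
    then show ?thesis using comp[of Lo Lo Full Hi] by (simp add: eval del: face.simps(1,2))
  next
    assume "x = Hi" "y = Lo"
    then show ?thesis using comp[of Hi Hi Lo Lo] by (simp add: eval del: face.simps(1,2))
  next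
    assume xy: "x = Hi" "y = Hi"
    \<comment> \<open>The pieces \<open>Lo\<close> and \<open>Hi\<close> are not composable, so the
      left side of \<open>comp\<close> is zero and the two unknown summands are the coefficients at
      the corners; one is thereby expressed through the other.\<close>
    have "f Full Full (face Lo (Yl q)) (face Lo (Yr p)) = \<Gamma>"
      using coeff_\<Gamma>[OF assms] by (simp add: f_def)
    then show ?thesis using comp[of Lo Hi Lo Hi] neq xy
      by (simp add: eval aut eq_neg_iff_add_eq_0 algebra_simps del: face.simps(1,2))
  next
    assume "x = Hi" "y = Full"
    then show ?thesis using comp[of Hi Hi Lo Full] by (simp add: eval del: face.simps(1,2))
  next
    assume "x = Full" "y = Lo"
    then show ?thesis using comp[of Full Hi Lo Lo] by (simp add: eval del: face.simps(1,2))
  next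
    assume "x = Full" "y = Hi"
    then show ?thesis using comp[of Lo Full Hi Hi] by (simp add: eval del: face.simps(1,2))
  next
    assume "x = Full" "y = Full"
    then show ?thesis using comp[of Full Hi Lo Full] by (simp add: eval del: face.simps(1,2))
  qed
  then show "r (axis (p, q) 1) $ (face x (Yl q), face y (Yr p)) = cc Full Full x y"
    by (simp add: f_def)
  assume "r (axis (p, q) 1) $ (p', q') \<noteq> 0"
  then have nz: "f Full Full p' q' \<noteq> 0" by (simp add: f_def)
  show "\<exists>x y. p' = face x (Yl q) \<and> q' = face y (Yr p)"
  proof (rule ccontr)
    assume not: "\<not> ?thesis"
    then have z: "f Lo Full p' q' = 0" "f Hi Full p' q' = 0" "f Full Lo p' q' = 0" "f Full Hi p' q' = 0"
      "\<not> (p' = face x (Yl q) \<and> q' = face y (Yr p))" for x y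
      using f2 by blast+
    \<comment> \<open>Off the faces all mixed terms vanish. Cutting at the lower ends forces the
      lower ends of \<open>Yl q\<close> and \<open>Yr p\<close>, cutting at the upper ends their
      upper ends, so the pair would be a pair of faces after all.\<close>
    have "face Lo p' = face Lo (Yl q) \<and> face Lo q' = face Lo (Yr p)"
      using split[of "face Lo p'" p' "face Lo q'" q'] nz z(1-4) z(5)[of Hi Hi] by (auto split: if_splits)
    moreover have "face Hi p' = face Hi (Yl q) \<and> face Hi q' = face Hi (Yr p)"
      using split[of p' "face Hi p'" q' "face Hi q'"] nz z(1-4) z(5)[of Lo Lo] by (auto split: if_splits)
    ultimately have "p' = face Full (Yl q)" "q' = face Full (Yr p)"
      by (metis Ivl_lo_hi face.simps lo_Ivl order.refl)+
    with z show False by blast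
  qed
qed

text \<open>The matrix \<open>cc\<close> does not depend on \<open>p\<close> and \<open>q\<close>,
  which enter only through their translates; this makes the reduction to the chain possible.\<close>

lemma r_faces:
  assumes "lo p < hi p" "lo q < hi q"
  shows "r (axis (face s p, face t q) 1) =
    (\<Sum>x\<in>UNIV. \<Sum>y\<in>UNIV. cc s t x y *s axis (face x (Yl q), face y (Yr p)) 1)"
proof (rule vec_eq_sum_faces[OF strict_map(1)[OF assms(2)] strict_map(2)[OF assms(1)]])
  have pt: "r (axis (face s p, face t q) 1) = axis (face t (Yl q), face s (Yr p)) 1" if "s \<noteq> Full" "t \<noteq> Full"
    using that by (cases s; cases t) (simp_all add: r_point aut)
  show "r (axis (face s p, face t q) 1) $ (face x (Yl q), face y (Yr p)) = cc s t x y" for x y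
  proof (cases "s = Full"; cases "t = Full")
    assume *: "s \<noteq> Full" "t \<noteq> Full"
    then show ?thesis
      using assms by (auto simp: pt axis_1_nth cell_coeff_def face_eq_iff strict_map)
  qed (use r_point_full(1) r_full_point(1) r_full_full(1) assms in auto)
  show "\<exists>x y. p' = face x (Yl q) \<and> q' = face y (Yr p)"
    if "r (axis (face s p, face t q) 1) $ (p', q') \<noteq> 0" for p' q'
  proof (cases "s = Full"; cases "t = Full")
    assume *: "s \<noteq> Full" "t \<noteq> Full"
    then show ?thesis
      using that by (auto simp: pt axis_1_nth split: if_splits)
  qed (use that r_point_full(2)[of s p q p' q'] r_full_point(2)[of t p q p' q'] r_full_full(2)[of p q p' q']
      assms in auto)
qed

end

section \<open>Reduction of the braid equation to the chain\<close>

text \<open>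
  Tensors over the chain are handled through linear functionals: \<open>cell_apply c s t F\<close> is the value
  of \<open>F\<close> on the image of the basis vector \<open>s \<otimes> t\<close>.
\<close>

definition cell_apply ::
    "(cell \<Rightarrow> cell \<Rightarrow> cell \<Rightarrow> cell \<Rightarrow> 'k::field) \<Rightarrow> cell \<Rightarrow> cell \<Rightarrow> (cell \<Rightarrow> cell \<Rightarrow> 'k) \<Rightarrow> 'k"
  where "cell_apply c s t F = (\<Sum>x\<in>UNIV. \<Sum>y\<in>UNIV. c s t x y * F x y)"

text \<open>The nesting lists the maps in the order in which they act, the outermost first: on
  places one and two, then two and three, then one and two.\<close>

definition cell_braid_left ::
    "(cell \<Rightarrow> cell \<Rightarrow> cell \<Rightarrow> cell \<Rightarrow> 'k::field) \<Rightarrow> cell \<Rightarrow> cell \<Rightarrow> cell \<Rightarrow> (cell \<Rightarrow> cell \<Rightarrow> cell \<Rightarrow> 'k) \<Rightarrow> 'k"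
  where "cell_braid_left c s t w F =
    cell_apply c s t (\<lambda>x1 y1. cell_apply c y1 w (\<lambda>y2 z. cell_apply c x1 y2 (\<lambda>x y. F x y z)))"

definition cell_braid_right ::
    "(cell \<Rightarrow> cell \<Rightarrow> cell \<Rightarrow> cell \<Rightarrow> 'k::field) \<Rightarrow> cell \<Rightarrow> cell \<Rightarrow> cell \<Rightarrow> (cell \<Rightarrow> cell \<Rightarrow> cell \<Rightarrow> 'k) \<Rightarrow> 'k"
  where "cell_braid_right c s t w F =
    cell_apply c t w (\<lambda>y1 z1. cell_apply c s y1 (\<lambda>x y2. cell_apply c y2 z1 (\<lambda>y z. F x y z)))"

text \<open>Coordinate functional that extracts a single scalar component.\<close>

definition cell_delta :: "cell \<Rightarrow> cell \<Rightarrow> cell \<Rightarrow> cell \<Rightarrow> cell \<Rightarrow> cell \<Rightarrow> 'k::field"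
  where "cell_delta x1 y1 z1 x y z = (if x = x1 \<and> y = y1 \<and> z = z1 then 1 else 0)"

lemma linear_comp:
  assumes "Vector_Spaces.linear (*s) (*s) f" "Vector_Spaces.linear (*s) (*s) g"
  shows "Vector_Spaces.linear (*s) (*s) (g \<circ> f)"
  using Vector_Spaces.linear_compose[OF assms] .

lemma linear_sum_scale:
  assumes "Vector_Spaces.linear (*s) (*s) f"
  shows "f (\<Sum>x\<in>A. \<Sum>y\<in>B. c x y *s v x y) = (\<Sum>x\<in>A. \<Sum>y\<in>B. c x y *s f (v x y))"
proof -
  interpret f: Vector_Spaces.linear "(*s)" "(*s)" f by fact
  show ?thesis by (simp add: f.sum f.scale)
qed

lemma tens_sum_left:
  "(\<Sum>x\<in>A. \<Sum>y\<in>B. c x y *s v x y) \<otimes>\<^sub>v w = (\<Sum>x\<in>A. \<Sum>y\<in>B. c x y *s (v x y \<otimes>\<^sub>v w))"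
  by (simp add: vec_eq_iff tens_def sum_distrib_right mult.assoc)

lemma tens_sum_right:
  "w \<otimes>\<^sub>v (\<Sum>x\<in>A. \<Sum>y\<in>B. c x y *s v x y) = (\<Sum>x\<in>A. \<Sum>y\<in>B. c x y *s (w \<otimes>\<^sub>v v x y))"
  by (simp add: vec_eq_iff tens_def sum_distrib_left mult.left_commute)

text \<open>A degenerate interval is an end of any strict interval that starts or stops at its
  point, and comparability provides one. Thus the faces exhaust the basis of
  \<open>D\<close>.\<close>

lemma strict_face_exhaust:
  assumes "\<And>x :: 'x::order. \<exists>y. x < y \<or> y < x"
  shows "\<exists>t p0. lo p0 < hi p0 \<and> p = face t (p0 :: 'x ivl)"
proof (cases "lo p < hi p")
  case True
  then show ?thesis by (metis face.simps(3))
next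
  case False
  then have "lo p = hi p" using lo_le_hi[of p] by auto
  then have p: "p = Ivl (lo p) (lo p)" by (metis Ivl_lo_hi)
  from assms[of "lo p"] obtain y where "lo p < y \<or> y < lo p" by blast
  then show ?thesis
  proof
    assume "lo p < y"
    then show ?thesis using p by (intro exI[of _ Lo] exI[of _ "Ivl (lo p) y"]) auto
  next
    assume "y < lo p"
    then show ?thesis using p by (intro exI[of _ Hi] exI[of _ "Ivl y (lo p)"]) auto
  qed
qed

section \<open>The two composites on triples of faces\<close>

context height_one_flip
begin

definition "R12 = assoc_r \<circ> (r \<otimes>\<^sub>m id) \<circ> assoc_l"
definition "R23 = (id :: 'k ^ 'x ivl \<Rightarrow> _) \<otimes>\<^sub>m r"

lemma linear_r: "Vector_Spaces.linear (*s) (*s) r"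
  using coalg by (simp add: DD_coalgebra_aut_def coalgebra_aut_def coalgebra_hom_def)

lemma linear_R12: "Vector_Spaces.linear (*s) (*s) (R12 :: 'k ^ ('x ivl \<times> 'x ivl \<times> 'x ivl) \<Rightarrow> _)"
  unfolding R12_def by (intro linear_comp linear_assoc_l linear_assoc_r linear_tens_map)

lemma linear_R23: "Vector_Spaces.linear (*s) (*s) R23"
  unfolding R23_def by (rule linear_tens_map)

lemma R12_faces:
  assumes "lo p < hi p" "lo q < hi q"
  shows "R12 (axis (face s p, face t q, m) 1) =
    (\<Sum>x\<in>UNIV. \<Sum>y\<in>UNIV. cc s t x y *s axis (face x (Yl q), face y (Yr p), m) 1)"
  by (simp add: R12_def assoc_l_axis tens_map_axis r_faces[OF assms] tens_sum_left tens_axis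
      linear_sum_scale[OF linear_assoc_r] assoc_r_axis)

lemma R23_faces:
  assumes "lo p < hi p" "lo q < hi q"
  shows "R23 (axis (m, face s p, face t q) 1) =
    (\<Sum>x\<in>UNIV. \<Sum>y\<in>UNIV. cc s t x y *s axis (m, face x (Yl q), face y (Yr p)) 1)"
  by (simp add: R23_def tens_map_axis r_faces[OF assms] tens_sum_right tens_axis)

text \<open>The intervals \<open>p\<close> and \<open>m\<close> are translated twice on the same
  side, \<open>q\<close> once on each side. The other composite translates \<open>q\<close> in the
  opposite order, which is where commutation of \<open>\<phi>\<^sub>l\<close> and
  \<open>\<phi>\<^sub>r\<close> enters.\<close>

lemma braid_left_faces:
  assumes "lo p < hi p" "lo q < hi q" "lo m < hi m"
  shows "R12 (R23 (R12 (axis (face s p, face t q, face w m) 1))) $ J =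
    cell_braid_left cc s t w
      (\<lambda>x y z. axis (face x (Yl (Yl m)), face y (Yr (Yl q)), face z (Yr (Yr p))) 1 $ J)"
  by (simp add: R12_faces R23_faces assms strict_map linear_sum_scale[OF linear_R12]
      linear_sum_scale[OF linear_R23] cell_braid_left_def cell_apply_def)

lemma braid_right_faces:
  assumes "lo p < hi p" "lo q < hi q" "lo m < hi m"
  shows "R23 (R12 (R23 (axis (face s p, face t q, face w m) 1))) $ J =
    cell_braid_right cc s t w
      (\<lambda>x y z. axis (face x (Yl (Yl m)), face y (Yl (Yr q)), face z (Yr (Yr p))) 1 $ J)"
  by (simp add: R12_faces R23_faces assms strict_map linear_sum_scale[OF linear_R12]
      linear_sum_scale[OF linear_R23] cell_braid_right_def cell_apply_def)

lemma map_ivl_commute: "\<phi>\<^sub>l \<circ> \<phi>\<^sub>r = \<phi>\<^sub>r \<circ> \<phi>\<^sub>l \<Longrightarrow> Yl (Yr p) = Yr (Yl p)"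
  by (rule ivl_eqI) (simp_all add: aut fun_eq_iff)

lemma braid_solution_eq: "braid_solution r \<longleftrightarrow> R12 \<circ> R23 \<circ> R12 = R23 \<circ> R12 \<circ> R23"
  by (simp add: braid_solution_def R12_def R23_def Let_def)

lemma braid_solutionI:
  assumes comm: "\<phi>\<^sub>l \<circ> \<phi>\<^sub>r = \<phi>\<^sub>r \<circ> \<phi>\<^sub>l" and comparable: "\<And>x :: 'x. \<exists>y. x < y \<or> y < x"
    and cells: "\<And>s t w F. cell_braid_left cc s t w F = cell_braid_right cc s t w F"
  shows "braid_solution r"
  unfolding braid_solution_eq
proof (rule linear_eq_on_axis)
  fix i :: "'x ivl \<times> 'x ivl \<times> 'x ivl"
  obtain p' q' m' where i: "i = (p', q', m')" by (cases i) auto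
  obtain s p where p: "lo p < hi p" "p' = face s p" using strict_face_exhaust[OF comparable] by blast
  obtain t q where q: "lo q < hi q" "q' = face t q" using strict_face_exhaust[OF comparable] by blast
  obtain w m where m: "lo m < hi m" "m' = face w m" using strict_face_exhaust[OF comparable] by blast
  show "(R12 \<circ> R23 \<circ> R12) (axis i 1) = (R23 \<circ> R12 \<circ> R23) (axis i 1)"
    by (simp only: vec_eq_iff o_apply i p(2) q(2) m(2) braid_left_faces[OF p(1) q(1) m(1)]
        braid_right_faces[OF p(1) q(1) m(1)] cells map_ivl_commute[OF comm]) simp
qed (intro linear_comp linear_R12 linear_R23)+

text \<open>One strict interval in all three places suffices: its faces are distinct, so the
  coordinate \<open>J\<close> reads off exactly the \<open>cell_delta\<close> component.\<close>

lemma braid_solutionD: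
  assumes comm: "\<phi>\<^sub>l \<circ> \<phi>\<^sub>r = \<phi>\<^sub>r \<circ> \<phi>\<^sub>l" and "x0 < (y0 :: 'x)" and braid: "braid_solution r"
  shows "cell_braid_left cc s t w (cell_delta x1 y1 z1) = cell_braid_right cc s t w (cell_delta x1 y1 z1)"
proof -
  define p where "p = Ivl x0 y0"
  have p: "lo p < hi p" using assms(2) by (simp add: p_def)
  define J where "J = (face x1 (Yl (Yl p)), face y1 (Yr (Yl p)), face z1 (Yr (Yr p)))"
  have "cell_delta x1 y1 z1 x y z = axis (face x (Yl (Yl p)), face y (Yr (Yl p)), face z (Yr (Yr p))) 1 $ J" for x y z
    using p by (simp add: cell_delta_def J_def axis_1_nth face_eq_iff strict_map eq_commute)
  then have delta: "cell_delta x1 y1 z1 = (\<lambda>x y z. axis (face x (Yl (Yl p)), face y (Yr (Yl p)), face z (Yr (Yr p))) 1 $ J)"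
    by blast
  have "R12 (R23 (R12 v)) = R23 (R12 (R23 v))" for v
    using braid by (simp add: braid_solution_eq fun_eq_iff)
  then show ?thesis
    using braid_left_faces[OF p p p, of s t w J] braid_right_faces[OF p p p, of s t w J]
    unfolding delta map_ivl_commute[OF comm] by metis
qed

text \<open>Applying \<open>r\<close> twice to (strict interval) \<otimes> (end \<open>t\<close>)
  uses the right coefficients first and the left ones second. Comparing the components
  (\<open>Full\<close>, \<open>t\<close>) and (\<open>Lo\<close>, \<open>t\<close>) makes the right
  coefficients functions of the left ones.\<close>

lemma square_coeffs:
  assumes comm: "\<phi>\<^sub>l \<circ> \<phi>\<^sub>r = \<phi>\<^sub>r \<circ> \<phi>\<^sub>l" and "x0 < (y0 :: 'x)"
    and square: "set_type_square_height1 \<phi>\<^sub>l \<phi>\<^sub>r r" and t: "t \<noteq> Full"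
  shows "R t Full * L t Full = 1" and "R t Lo = - (R t Full * L t Lo)"
proof -
  define p where "p = Ivl x0 y0"
  have p: "lo p < hi p" using assms(2) by (simp add: p_def)
  define p2 where "p2 = Yr (Yl p)"
  have p2: "Yl (Yr p) = p2" "lo p2 < hi p2"
    using p by (simp_all add: p2_def map_ivl_commute[OF comm] strict_map)
  have p2_Ivl: "Ivl (\<phi>\<^sub>l (\<phi>\<^sub>r (lo p))) (\<phi>\<^sub>l (\<phi>\<^sub>r (hi p))) = p2"
    unfolding p2(1)[symmetric] map_ivl_def[of \<phi>\<^sub>l "Yr p"] by (simp add: aut)
  define z where "z = (if t = Lo then lo p else hi p)"
  have z: "face t p = Ivl z z" "face t p2 = Ivl (\<phi>\<^sub>l (\<phi>\<^sub>r z)) (\<phi>\<^sub>l (\<phi>\<^sub>r z))"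
    unfolding p2(1)[symmetric] using t by (cases t; simp add: z_def aut)+
  have "r (r (axis (p, face t p) 1)) $ J =
      cell_apply cc Full t (\<lambda>x y. cell_apply cc x y
        (\<lambda>x' y'. axis (face x' p2, face y' p2) 1 $ J))" for J
    using r_faces[OF p p, of Full t]
    by (simp add: linear_sum_scale[OF linear_r] r_faces strict_map p cell_apply_def p2(1) p2_def[symmetric])
  moreover have "r (r (axis (p, face t p) 1)) = axis (p2, face t p2) 1"
    using square[unfolded set_type_square_height1_def Let_def, rule_format, of "lo p" "hi p" z z] p
    by (simp add: bas_def tens_axis z(1) z(2)[symmetric] p2_Ivl)
  ultimately have eq: "axis (face Full p2, face t p2) 1 $ (face x p2, face y p2) =
      cell_apply cc Full t (\<lambda>x1 y1. cell_apply cc x1 y1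
        (\<lambda>x' y'. axis (face x' p2, face y' p2) 1 $ (face x p2, face y p2)))" for x y
    by simp
  have *: "(if x = Full \<and> y = t then 1 else 0) =
      cell_apply cc Full t (\<lambda>x1 y1. cc x1 y1 x y)" for x y
    using eq[of x y]
    by (cases x; cases y) (simp_all add: axis_1_nth face_eq_iff p2(2) cell_apply_def sum_cell del: face.simps)
  show "R t Full * L t Full = 1"
    using *[of Full t] t by (cases t) (simp_all add: cell_apply_def sum_cell cell_coeff_def)
  show "R t Lo = - (R t Full * L t Lo)"
    using *[of Lo t] t by (cases t) (simp_all add: cell_apply_def sum_cell cell_coeff_def eq_neg_iff_add_eq_0)
qed

end

section \<open>The braid equation on the chain\<close>

text \<open>The sign at \<open>Hi\<close> builds in \<open>L_Hi\<close> and \<open>R_Hi\<close>; a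
  first label other than \<open>Lo\<close> takes the values for \<open>Hi\<close>.\<close>

fun edge_coeff :: "'k::field \<Rightarrow> 'k \<Rightarrow> 'k \<Rightarrow> 'k \<Rightarrow> cell \<Rightarrow> cell \<Rightarrow> 'k" where
  "edge_coeff k1 k2 p1 p2 s Full = (if s = Lo then k1 else k2)"
| "edge_coeff k1 k2 p1 p2 s Lo = (if s = Lo then p1 else p2)"
| "edge_coeff k1 k2 p1 p2 s Hi = - (if s = Lo then p1 else p2)"

text \<open>\<open>b\<close> stands for the inverse of \<open>a\<close>: the square condition makes the right coefficients the
  inverses of the left ones.\<close>

definition braid_coeff ::
    "'k::field \<Rightarrow> 'k \<Rightarrow> 'k \<Rightarrow> 'k \<Rightarrow> 'k \<Rightarrow> 'k \<Rightarrow> cell \<Rightarrow> cell \<Rightarrow> cell \<Rightarrow> cell \<Rightarrow> 'k"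
  where "braid_coeff e a b p q g =
    cell_coeff (edge_coeff a (e * a) p q) (edge_coeff b (e * b) (- (b * p)) (- (e * b * q))) g"

lemma cell_apply_simps:
  "cell_apply (braid_coeff e a b p q g) Lo Lo F = F Lo Lo"
  "cell_apply (braid_coeff e a b p q g) Lo Hi F = F Hi Lo"
  "cell_apply (braid_coeff e a b p q g) Hi Lo F = F Lo Hi"
  "cell_apply (braid_coeff e a b p q g) Hi Hi F = F Hi Hi"
  "cell_apply (braid_coeff e a b p q g) Lo Full F = a * F Full Lo + p * (F Lo Lo - F Hi Lo)"
  "cell_apply (braid_coeff e a b p q g) Hi Full F = e * a * F Full Hi + q * (F Lo Hi - F Hi Hi)"
  "cell_apply (braid_coeff e a b p q g) Full Lo F = b * (F Lo Full - p * (F Lo Lo - F Lo Hi))"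
  "cell_apply (braid_coeff e a b p q g) Full Hi F = e * b * (F Hi Full - q * (F Hi Lo - F Hi Hi))"
  by (simp_all add: cell_apply_def braid_coeff_def sum_cell cell_coeff_def algebra_simps)

text \<open>Every product of a left and a right coefficient that contains \<open>a\<close> also
  contains \<open>b\<close>, so the hypothesis clears both.\<close>

lemma cell_apply_Full_Full:
  "a * b = 1 \<Longrightarrow> cell_apply (braid_coeff e a b p q g) Full Full F =
    e * F Full Full + e * (p * F Full Hi - q * F Full Lo) + b * (q * F Lo Full - e * p * F Hi Full)
    + g * (F Lo Lo - F Hi Hi) + b * p * q * (F Lo Hi - F Hi Hi + e * (F Hi Lo - F Hi Hi))"
  by (simp add: cell_apply_def braid_coeff_def sum_cell cell_coeff_def) algebra

lemmas cell_braid_simps =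
  cell_braid_left_def cell_braid_right_def cell_apply_simps cell_apply_Full_Full

section \<open>Families that satisfy the equation\<close>

definition cell_braid :: "(cell \<Rightarrow> cell \<Rightarrow> cell \<Rightarrow> cell \<Rightarrow> 'k::field) \<Rightarrow> bool"
  where "cell_braid c \<longleftrightarrow> (\<forall>s t w F. cell_braid_left c s t w F = cell_braid_right c s t w F)"

text \<open>For each of the 27 inputs both sides are linear in the values of \<open>F\<close>, and
  matching coefficients agree by ring arithmetic; the other families follow the same scheme.\<close>

lemma cell_braid_1: "cell_braid (braid_coeff 1 1 1 p p g)" (is "cell_braid ?c")
proof -
  have "cell_braid_left ?c s t w F = cell_braid_right ?c s t w F" for s t w F
    by (cases s; cases t; cases w; simp add: cell_braid_simps; simp add: algebra_simps)
  then show ?thesis by (simp add: cell_braid_def)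
qed

lemma cell_braid_2: "cell_braid (braid_coeff 1 1 1 p q (- (p * q)))" (is "cell_braid ?c")
proof -
  have "cell_braid_left ?c s t w F = cell_braid_right ?c s t w F" for s t w F
    by (cases s; cases t; cases w; simp add: cell_braid_simps; simp add: algebra_simps)
  then show ?thesis by (simp add: cell_braid_def)
qed

lemma cell_braid_3:
  fixes p q g :: "'k::field"
  assumes "CHAR('k) = 2"
  shows "cell_braid (braid_coeff 1 1 1 p q g)" (is "cell_braid ?c")
proof -
  \<comment> \<open>Characteristic two is turned into rewrite rules: signs disappear and equal
    summands cancel, \<open>double'\<close> doing so inside longer sums.\<close>
  have "(2 :: 'k) = 0" using of_nat_CHAR[where ?'a = 'k] assms by simp
  then have double: "x + x = 0" for x :: 'k by (metis mult_2 mult_zero_left)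
  then have double': "x + (x + y) = y" for x y :: 'k by (metis add.assoc add_0)
  have minus: "- x = x" for x :: 'k using double by (simp add: minus_unique)
  have diff: "x - y = x + y" for x y :: 'k using minus by (metis diff_conv_add_uminus)
  have "cell_braid_left ?c s t w F = cell_braid_right ?c s t w F" for s t w F
    by (cases s; cases t; cases w)
      (simp_all add: cell_braid_simps diff minus distrib_left ac_simps double double')
  then show ?thesis by (simp add: cell_braid_def)
qed

lemma cell_braid_4: "cell_braid (braid_coeff 1 (- 1) (- 1) p p g)" (is "cell_braid ?c")
proof -
  have "cell_braid_left ?c s t w F = cell_braid_right ?c s t w F" for s t w F
    by (cases s; cases t; cases w; simp add: cell_braid_simps; simp add: algebra_simps)
  then show ?thesis by (simp add: cell_braid_def)
qed

lemma cell_braid_5: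
  fixes a b p :: "'k::field"
  assumes ab: "a * b = 1"
  shows "cell_braid (braid_coeff 1 a b p p (- (b * p\<^sup>2)))" (is "cell_braid ?c")
proof -
  \<comment> \<open>The relation in a form that also cancels inside longer products.\<close>
  have ab': "a * (b * x) = x" for x using ab by (metis mult.assoc mult_1)
  have "cell_braid_left ?c s t w F = cell_braid_right ?c s t w F" for s t w F
    by (cases s; cases t; cases w; simp add: cell_braid_simps ab;
        simp add: power2_eq_square algebra_simps ab ab')
  then show ?thesis by (simp add: cell_braid_def)
qed

lemma cell_braid_6: "cell_braid (braid_coeff (- 1) 1 1 0 q g)" (is "cell_braid ?c")
proof -
  have "cell_braid_left ?c s t w F = cell_braid_right ?c s t w F" for s t w F
    by (cases s; cases t; cases w; simp add: cell_braid_simps; simp add: algebra_simps)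
  then show ?thesis by (simp add: cell_braid_def)
qed

lemma cell_braid_7: "cell_braid (braid_coeff (- 1) (- 1) (- 1) p 0 g)" (is "cell_braid ?c")
proof -
  have "cell_braid_left ?c s t w F = cell_braid_right ?c s t w F" for s t w F
    by (cases s; cases t; cases w; simp add: cell_braid_simps; simp add: algebra_simps)
  then show ?thesis by (simp add: cell_braid_def)
qed

text \<open>With k = p / (1 - a) the eighth family becomes polynomial in \<open>a\<close>,
  \<open>b\<close> and \<open>k\<close>, so that no division remains in the check.\<close>

lemma cell_braid_8:
  fixes a b k :: "'k::field"
  assumes ab: "a * b = 1"
  shows "cell_braid (braid_coeff (- 1) a b ((1 - a) * k) ((1 + a) * k) (- ((a + b) * k\<^sup>2)))"
    (is "cell_braid ?c")
proof -
  have ab': "a * (b * x) = x" for x using ab by (metis mult.assoc mult_1)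
  have "cell_braid_left ?c s t w F = cell_braid_right ?c s t w F" for s t w F
    by (cases s; cases t; cases w; simp add: cell_braid_simps ab;
        simp add: power2_eq_square algebra_simps ab ab')
  then show ?thesis by (simp add: cell_braid_def)
qed

text \<open>The letters stand for \<epsilon>, \<alpha>, \<open>\<beta>\<^sub>a\<close>,
  \<open>\<beta>\<^sub>b\<close> and \<Gamma>; the disjuncts keep the order of the final statement,
  which is recovered by unfolding.\<close>

definition cell_braid_family :: "'k::field \<Rightarrow> 'k \<Rightarrow> 'k \<Rightarrow> 'k \<Rightarrow> 'k \<Rightarrow> bool"
  where "cell_braid_family e a p q g \<longleftrightarrow>
      (e = 1 \<and> a = 1 \<and> q = p)
    \<or> (e = 1 \<and> a = 1 \<and> g = - (p * q) \<and> q \<noteq> p \<and> CHAR('k) \<noteq> 2)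
    \<or> (e = 1 \<and> a = 1 \<and> q \<noteq> p \<and> CHAR('k) = 2)
    \<or> (e = 1 \<and> a = -1 \<and> q = p)
    \<or> (e = 1 \<and> q = p \<and> g = - (p\<^sup>2 / a) \<and> a \<noteq> 0 \<and> a\<^sup>2 \<noteq> 1)
    \<or> (e = -1 \<and> a = 1 \<and> p = 0)
    \<or> (e = -1 \<and> a = -1 \<and> q = 0)
    \<or> (e = -1 \<and> q = p * ((1 + a) / (1 - a))
         \<and> g = - (p\<^sup>2 * (1 + a\<^sup>2) / (a * (1 - a)\<^sup>2)) \<and> a \<noteq> 0 \<and> a\<^sup>2 \<noteq> 1)"

lemma cell_braid_if_family:
  fixes e a b p q g :: "'k::field"
  assumes ab: "a * b = 1" and fam: "cell_braid_family e a p q g"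
  shows "cell_braid (braid_coeff e a b p q g)"
proof -
  have b: "b = 1" if "a = 1" using ab that by simp
  have b': "b = - 1" if "a = - 1" using ab that by (metis add.inverse_inverse mult_minus1)
  have div: "x / a = b * x" for x
    using ab by (metis divide_inverse inverse_unique mult.commute)
  have 8: "cell_braid (braid_coeff e a b p q g)"
    if "e = -1" "q = p * ((1 + a) / (1 - a))" "g = - (p\<^sup>2 * (1 + a\<^sup>2) / (a * (1 - a)\<^sup>2))" "a\<^sup>2 \<noteq> 1"
  proof -
    define k where "k = p / (1 - a)"
    have a: "1 - a \<noteq> 0" using that(4) by auto
    have p: "p = (1 - a) * k" using a by (simp add: k_def)
    have q: "q = (1 + a) * k" using a by (simp add: k_def that(2))
    have "(1 + a\<^sup>2) / a = a + b"
      using ab by (simp add: div) algebra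
    moreover have "g = - ((1 + a\<^sup>2) / a * k\<^sup>2)"
      by (simp add: that(3) k_def power_divide)
    ultimately have g: "g = - ((a + b) * k\<^sup>2)" by simp
    show ?thesis unfolding \<open>e = -1\<close> p q g by (rule cell_braid_8[OF ab])
  qed
  show ?thesis
  \<comment> \<open>Only the eighth family needs the change of parameter; it is split off
    first.\<close>
  proof (cases "e = -1 \<and> q = p * ((1 + a) / (1 - a))
      \<and> g = - (p\<^sup>2 * (1 + a\<^sup>2) / (a * (1 - a)\<^sup>2)) \<and> a\<^sup>2 \<noteq> 1")
    case True
    then show ?thesis using 8 by blast
  next
    case False
    with fam show ?thesis
      unfolding cell_braid_family_def
      by (elim disjE)
        (auto simp only: b b' div cell_braid_1 cell_braid_2 cell_braid_3 cell_braid_4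
          cell_braid_5[OF ab] cell_braid_6 cell_braid_7)
  qed
qed

text \<open>The first equation is linear in \<open>p\<close> and \<open>q\<close> and ties them
  together; the second determines \<open>g\<close> unless a^2 = 1. Both are void at e = a = 1, where
  the third takes over.\<close>

lemma family_if_equations:
  fixes e a b p q g :: "'k::field"
  assumes ab: "a * b = 1" and e: "e \<in> {1, -1}"
    and 1: "b * (q - p) - q + e * p = 0"
    and 2: "b * p * q + g - e * p * q + e * p\<^sup>2 - a * p\<^sup>2 - a\<^sup>2 * g = 0"
    and 3: "e = 1 \<Longrightarrow> a = 1 \<Longrightarrow> 2 * ((q - p) * (g + p * q)) = 0"
  shows "cell_braid_family e a p q g"
proof -
  have a0: "a \<noteq> 0" using ab by auto
  have div: "x / a = b * x" for x
    using ab by (metis divide_inverse inverse_unique mult.commute)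
  have two: "(2 :: 'k) \<noteq> 0" if "CHAR('k) \<noteq> 2"
  proof
    assume "(2 :: 'k) = 0"
    then have "CHAR('k) dvd 2" using of_nat_eq_0_iff_char_dvd[of 2, where ?'a = 'k] by simp
    then have "CHAR('k) \<le> 2" by (simp add: dvd_imp_le)
    moreover have "CHAR('k) \<noteq> 0" using \<open>CHAR('k) dvd 2\<close> by (rule contrapos_pn) simp
    moreover have "CHAR('k) \<noteq> 1" using CHAR_not_1 by simp
    ultimately show False using that by simp
  qed
  show ?thesis
  proof (cases "e = 1")
    case True
    have q: "(1 - a) * (q - p) = 0" using 1 ab True by algebra
    show ?thesis
    proof (cases "a = 1")
      case True
      show ?thesis
      proof (cases "q = p \<or> CHAR('k) = 2")
        case False
        then have "g + p * q = 0" using 3[OF \<open>e = 1\<close> True] two by simp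
        then have "g = - (p * q)" by (simp add: eq_neg_iff_add_eq_0)
        then show ?thesis using False True \<open>e = 1\<close> by (simp add: cell_braid_family_def)
      qed (use True \<open>e = 1\<close> in \<open>auto simp: cell_braid_family_def\<close>)
    next
      case False
      then have q: "q = p" using q by simp
      show ?thesis
      proof (cases "a\<^sup>2 = 1")
        case True
        then have "a = -1" using False by (simp add: power2_eq_1_iff)
        then show ?thesis using q \<open>e = 1\<close> by (simp add: cell_braid_family_def)
      next
        case False
        \<comment> \<open>Since b - a = b (1 - a^2), the terms in \<open>g\<close> and p^2 share the
          factor 1 - a^2.\<close>
        have "(1 - a\<^sup>2) * (g + b * p\<^sup>2) = 0" using 2 ab q \<open>e = 1\<close> by algebra
        then have "g = - (p\<^sup>2 / a)" using False by (simp add: div eq_neg_iff_add_eq_0)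
        then show ?thesis using q \<open>e = 1\<close> False a0 by (simp add: cell_braid_family_def)
      qed
    qed
  next
    case False
    then have e: "e = -1" using e by simp
    \<comment> \<open>In characteristic two the values 1 and -1 of \<open>e\<close> coincide, and
      that case is already settled.\<close>
    have two: "(2 :: 'k) \<noteq> 0"
    proof
      assume "(2 :: 'k) = 0"
      then have "(1 :: 'k) = -1" by (metis one_add_one eq_neg_iff_add_eq_0)
      with e \<open>e \<noteq> 1\<close> show False by simp
    qed
    have q: "(1 - a) * q = (1 + a) * p" using 1 ab e by algebra
    consider "a = 1" | "a = -1" | "a\<^sup>2 \<noteq> 1" by (auto simp: power2_eq_1_iff)
    then show ?thesis
    proof cases
      assume a: "a = 1"
      then show ?thesis using q two e by (simp add: cell_braid_family_def)
    next
      assume a: "a = -1"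
      then show ?thesis using q two e by (simp add: cell_braid_family_def)
    next
      assume a: "a\<^sup>2 \<noteq> 1"
      then have a1: "1 - a \<noteq> 0" by auto
      then have q': "q = p * ((1 + a) / (1 - a))" using q by (simp add: field_simps)
      \<comment> \<open>The second equation times a (1 - a)^2, with (1 - a) q replaced by (1 + a)
        p.\<close>
      have "(1 - a\<^sup>2) * (g * (a * (1 - a)\<^sup>2) + p\<^sup>2 * (1 + a\<^sup>2)) = 0"
        using 2 ab q e by algebra
      then have "g * (a * (1 - a)\<^sup>2) = - (p\<^sup>2 * (1 + a\<^sup>2))"
        using a by (simp add: eq_neg_iff_add_eq_0)
      then have "g = - (p\<^sup>2 * (1 + a\<^sup>2) / (a * (1 - a)\<^sup>2))"
        using a0 a1 by (subst minus_divide_left, subst nonzero_eq_divide_eq) simp_all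
      then show ?thesis using a a0 q' e by (simp add: cell_braid_family_def)
    qed
  qed
qed

text \<open>The components have one, two and three strict intervals among their inputs. The third is
  evaluated only at e = a = 1, the case that the first two leave undecided.\<close>

lemma cell_braid_equations:
  fixes e a b p q g :: "'k::field"
  defines "c \<equiv> braid_coeff e a b p q g"
  assumes ab: "a * b = 1"
  shows "cell_braid_left c Hi Full Lo (cell_delta Lo Hi Hi) =
        cell_braid_right c Hi Full Lo (cell_delta Lo Hi Hi) \<Longrightarrow>
      b * (q - p) - q + e * p = 0"
    and "cell_braid_left c Lo Full Full (cell_delta Lo Lo Lo) =
        cell_braid_right c Lo Full Full (cell_delta Lo Lo Lo) \<Longrightarrow>
      b * p * q + g - e * p * q + e * p\<^sup>2 - a * p\<^sup>2 - a\<^sup>2 * g = 0"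
    and "cell_braid_left c Full Full Full (cell_delta Lo Lo Lo) =
        cell_braid_right c Full Full Full (cell_delta Lo Lo Lo) \<Longrightarrow>
      e = 1 \<Longrightarrow> a = 1 \<Longrightarrow> 2 * ((q - p) * (g + p * q)) = 0"
proof -
  have b: "b = 1" if "a = 1" using ab that by simp
  show "b * (q - p) - q + e * p = 0"
    if "cell_braid_left c Hi Full Lo (cell_delta Lo Hi Hi) =
      cell_braid_right c Hi Full Lo (cell_delta Lo Hi Hi)"
    using that ab by (simp add: c_def cell_braid_simps cell_delta_def) algebra
  show "b * p * q + g - e * p * q + e * p\<^sup>2 - a * p\<^sup>2 - a\<^sup>2 * g = 0"
    if "cell_braid_left c Lo Full Full (cell_delta Lo Lo Lo) =
      cell_braid_right c Lo Full Full (cell_delta Lo Lo Lo)"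
    using that ab by (simp add: c_def cell_braid_simps cell_delta_def) algebra
  assume e: "e = 1" and a: "a = 1"
  have "cell_braid_right c Full Full Full (cell_delta Lo Lo Lo)
      - cell_braid_left c Full Full Full (cell_delta Lo Lo Lo) = 2 * ((q - p) * (g + p * q))"
    by (simp add: c_def cell_braid_simps cell_delta_def e a b[OF a]; simp add: algebra_simps)
  then show "2 * ((q - p) * (g + p * q)) = 0"
    if "cell_braid_left c Full Full Full (cell_delta Lo Lo Lo) =
      cell_braid_right c Full Full Full (cell_delta Lo Lo Lo)"
    using that by simp
qed

theorem theorem4p15:
  fixes u v :: nat
    and a b :: "nat \<Rightarrow> 'x::{finite, order}"
    and \<phi>\<^sub>l \<phi>\<^sub>r :: "'x \<Rightarrow> 'x"
    and \<sigma>\<^sub>a \<sigma>\<^sub>b \<tau>\<^sub>a \<tau>\<^sub>b :: "nat \<Rightarrow> nat"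
    and r :: "('k::field, 'x) DD_endo"
    and \<epsilon> \<alpha> \<beta>\<^sub>a \<beta>\<^sub>b \<Gamma> :: 'k
  assumes "u > 0" and "v > 0" and "coprime u v"
    and roots: "\<forall>x::'k. x \<noteq> 0 \<longrightarrow> card {y. y ^ (u * v) = x} = u * v"
    and poset: "bipartite_poset u v a b"
    and aut: "poset_aut \<phi>\<^sub>l" "poset_aut \<phi>\<^sub>r" "\<phi>\<^sub>l \<circ> \<phi>\<^sub>r = \<phi>\<^sub>r \<circ> \<phi>\<^sub>l"
    and perms: "\<sigma>\<^sub>a permutes {..<u}" "\<tau>\<^sub>a permutes {..<u}"
               "\<sigma>\<^sub>b permutes {..<v}" "\<tau>\<^sub>b permutes {..<v}"
    and perm_a: "\<forall>i<u. \<phi>\<^sub>l (a i) = a (\<sigma>\<^sub>a i) \<and> \<phi>\<^sub>r (a i) = a (\<tau>\<^sub>a i)"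
    and perm_b: "\<forall>j<v. \<phi>\<^sub>l (b j) = b (\<sigma>\<^sub>b j) \<and> \<phi>\<^sub>r (b j) = b (\<tau>\<^sub>b j)"
    and cycles: "cyclic_on (\<sigma>\<^sub>a \<circ> \<tau>\<^sub>a) {..<u}" "cyclic_on (\<sigma>\<^sub>b \<circ> \<tau>\<^sub>b) {..<v}"
    and r_aut: "DD_coalgebra_aut r"
    and r_nondeg: "non_degenerate r"
    and r_induces: "induces \<phi>\<^sub>l \<phi>\<^sub>r r"
    and r_square: "set_type_square_height1 \<phi>\<^sub>l \<phi>\<^sub>r r"
    and const_a: "\<forall>f \<in> {alpha_l \<phi>\<^sub>l \<phi>\<^sub>r r, alpha_r \<phi>\<^sub>l \<phi>\<^sub>r r, beta_l \<phi>\<^sub>l \<phi>\<^sub>r r, beta_r \<phi>\<^sub>l \<phi>\<^sub>r r}.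
        \<forall>i<u. \<forall>k<u. \<forall>m<v. f (a i) (a k) (b m) = f (a 0) (a 0) (b 0)"
    and const_b: "\<forall>f \<in> {alpha_l \<phi>\<^sub>l \<phi>\<^sub>r r, alpha_r \<phi>\<^sub>l \<phi>\<^sub>r r, beta_l \<phi>\<^sub>l \<phi>\<^sub>r r, beta_r \<phi>\<^sub>l \<phi>\<^sub>r r}.
        \<forall>j<v. \<forall>k<u. \<forall>m<v. f (b j) (a k) (b m) = f (b 0) (a 0) (b 0)"
    and const_Gamma: "\<forall>i<u. \<forall>j<v. \<forall>k<u. \<forall>l<v.
        Gamma4 \<phi>\<^sub>l \<phi>\<^sub>r r (a i) (b j) (a k) (b l) = \<Gamma>"
    and alpha: "\<alpha> = alpha_l \<phi>\<^sub>l \<phi>\<^sub>r r (a 0) (a 0) (b 0)"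
    and beta_a: "\<beta>\<^sub>a = beta_l \<phi>\<^sub>l \<phi>\<^sub>r r (a 0) (a 0) (b 0)"
    and beta_b: "\<beta>\<^sub>b = beta_l \<phi>\<^sub>l \<phi>\<^sub>r r (b 0) (a 0) (b 0)"
    and eps: "\<epsilon> \<in> {1, -1}" "alpha_l \<phi>\<^sub>l \<phi>\<^sub>r r (b 0) (a 0) (b 0) = \<epsilon> * \<alpha>"
  shows "(braid_solution r \<and> induces \<phi>\<^sub>l \<phi>\<^sub>r r \<and> set_type_square_height1 \<phi>\<^sub>l \<phi>\<^sub>r r) \<longleftrightarrow>
      (\<epsilon> = 1 \<and> \<alpha> = 1 \<and> \<beta>\<^sub>b = \<beta>\<^sub>a)
    \<or> (\<epsilon> = 1 \<and> \<alpha> = 1 \<and> \<Gamma> = - (\<beta>\<^sub>a * \<beta>\<^sub>b) \<and> \<beta>\<^sub>b \<noteq> \<beta>\<^sub>a \<and> CHAR('k) \<noteq> 2)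
    \<or> (\<epsilon> = 1 \<and> \<alpha> = 1 \<and> \<beta>\<^sub>b \<noteq> \<beta>\<^sub>a \<and> CHAR('k) = 2)
    \<or> (\<epsilon> = 1 \<and> \<alpha> = -1 \<and> \<beta>\<^sub>b = \<beta>\<^sub>a)
    \<or> (\<epsilon> = 1 \<and> \<beta>\<^sub>b = \<beta>\<^sub>a \<and> \<Gamma> = - (\<beta>\<^sub>a\<^sup>2 / \<alpha>) \<and> \<alpha> \<noteq> 0 \<and> \<alpha>\<^sup>2 \<noteq> 1)
    \<or> (\<epsilon> = -1 \<and> \<alpha> = 1 \<and> \<beta>\<^sub>a = 0)
    \<or> (\<epsilon> = -1 \<and> \<alpha> = -1 \<and> \<beta>\<^sub>b = 0)
    \<or> (\<epsilon> = -1 \<and> \<beta>\<^sub>b = \<beta>\<^sub>a * ((1 + \<alpha>) / (1 - \<alpha>))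
         \<and> \<Gamma> = - (\<beta>\<^sub>a\<^sup>2 * (1 + \<alpha>\<^sup>2) / (\<alpha> * (1 - \<alpha>)\<^sup>2)) \<and> \<alpha> \<noteq> 0 \<and> \<alpha>\<^sup>2 \<noteq> 1)"
proof -
  let ?al = "alpha_l \<phi>\<^sub>l \<phi>\<^sub>r r" and ?ar = "alpha_r \<phi>\<^sub>l \<phi>\<^sub>r r"
  let ?bl = "beta_l \<phi>\<^sub>l \<phi>\<^sub>r r" and ?br = "beta_r \<phi>\<^sub>l \<phi>\<^sub>r r"
  have UNIV: "UNIV = a ` {..<u} \<union> b ` {..<v}" and disj: "a ` {..<u} \<inter> b ` {..<v} = {}"
    and less: "x < y \<longleftrightarrow> (\<exists>i<u. \<exists>j<v. x = a i \<and> y = b j)" for x y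
    using poset by (auto simp: bipartite_poset_def)
  \<comment> \<open>An element strictly between would be both some \<open>a i\<close> and some
    \<open>b j\<close>.\<close>
  have thin: "{x..y} = {x, y}" if "x < y" for x y :: 'x
  proof -
    have "\<not> (x < z \<and> z < y)" for z using disj by (auto simp: less)
    then show ?thesis using that by (auto simp: order.order_iff_strict)
  qed
  have comparable: "\<exists>y. x < y \<or> y < x" for x :: 'x
  proof -
    have "x \<in> a ` {..<u} \<union> b ` {..<v}" using UNIV by blast
    then show ?thesis unfolding less using \<open>u > 0\<close> \<open>v > 0\<close> by blast
  qed
  have strict: "a 0 < b 0" using \<open>u > 0\<close> \<open>v > 0\<close> by (auto simp: less)
  have nth_left: "r (axis (Ivl z z, q) 1) $ (map_ivl \<phi>\<^sub>l q, Ivl (\<phi>\<^sub>r z) (\<phi>\<^sub>r z)) = ?al z (lo q) (hi q)"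
    "r (axis (Ivl z z, q) 1) $ (Ivl (\<phi>\<^sub>l (lo q)) (\<phi>\<^sub>l (lo q)), Ivl (\<phi>\<^sub>r z) (\<phi>\<^sub>r z)) = ?bl z (lo q) (hi q)"
    for z q
    by (simp_all add: alpha_l_def beta_l_def coeff_def bas_def tens_axis map_ivl_def)
  have nth_right: "r (axis (p, Ivl z z) 1) $ (Ivl (\<phi>\<^sub>l z) (\<phi>\<^sub>l z), map_ivl \<phi>\<^sub>r p) = ?ar z (lo p) (hi p)"
    "r (axis (p, Ivl z z) 1) $ (Ivl (\<phi>\<^sub>l z) (\<phi>\<^sub>l z), Ivl (\<phi>\<^sub>r (lo p)) (\<phi>\<^sub>r (lo p))) = ?br z (lo p) (hi p)"
    for z p
    by (simp_all add: alpha_r_def beta_r_def coeff_def bas_def tens_axis map_ivl_def)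
  \<comment> \<open>A strict interval runs from some \<open>a i\<close> to some \<open>b j\<close>,
    so the constancy hypotheses give independence both of the interval and of the one supplying the
    end.\<close>
  have const: "f (lo p) (lo q) (hi q) = f (a 0) (a 0) (b 0)" "f (hi p) (lo q) (hi q) = f (b 0) (a 0) (b 0)"
    if "f \<in> {?al, ?ar, ?bl, ?br}" "lo p < hi p" "lo q < hi q" for f p q
  proof -
    from that(2,3) obtain i j k m where
      "lo p = a i" "hi p = b j" "lo q = a k" "hi q = b m" "i < u" "j < v" "k < u" "m < v"
      unfolding less by blast
    then show "f (lo p) (lo q) (hi q) = f (a 0) (a 0) (b 0)" "f (hi p) (lo q) (hi q) = f (b 0) (a 0) (b 0)"
      using const_a[rule_format, OF that(1), of i k m] const_b[rule_format, OF that(1), of j k m] by simp_all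
  qed
  note comm = aut(3)
  define \<rho>\<^sub>a where "\<rho>\<^sub>a = ?ar (a 0) (a 0) (b 0)"
  define \<rho>\<^sub>b where "\<rho>\<^sub>b = ?ar (b 0) (a 0) (b 0)"
  interpret height_one_flip \<phi>\<^sub>l \<phi>\<^sub>r r "edge_coeff \<alpha> (\<epsilon> * \<alpha>) \<beta>\<^sub>a \<beta>\<^sub>b"
    "edge_coeff \<rho>\<^sub>a \<rho>\<^sub>b (?br (a 0) (a 0) (b 0)) (?br (b 0) (a 0) (b 0))" \<Gamma>
  proof
    show "r (axis (face s p, q) 1) $ (face x (map_ivl \<phi>\<^sub>l q), face s (map_ivl \<phi>\<^sub>r p)) =
        edge_coeff \<alpha> (\<epsilon> * \<alpha>) \<beta>\<^sub>a \<beta>\<^sub>b s x"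
      if "s \<noteq> Full" "x \<noteq> Hi" "lo p < hi p" "lo q < hi q" for s x p q
      using that aut const[OF _ that(3,4), of ?al] const[OF _ that(3,4), of ?bl] alpha beta_a beta_b eps(2)
      by (cases s; cases x) (simp_all add: nth_left)
    \<comment> \<open>Here \<open>p\<close> is the interval and \<open>q\<close> supplies the end,
      hence the exchanged premises of \<open>const\<close>.\<close>
    show "r (axis (p, face t q) 1) $ (face t (map_ivl \<phi>\<^sub>l q), face y (map_ivl \<phi>\<^sub>r p)) =
        edge_coeff \<rho>\<^sub>a \<rho>\<^sub>b (?br (a 0) (a 0) (b 0)) (?br (b 0) (a 0) (b 0)) t y"
      if "t \<noteq> Full" "y \<noteq> Hi" "lo p < hi p" "lo q < hi q" for t y p q
      using that aut const[OF _ that(4,3), of ?ar] const[OF _ that(4,3), of ?br]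
      by (cases t; cases y) (simp_all add: nth_right \<rho>\<^sub>a_def \<rho>\<^sub>b_def)
    show "r (axis (p, q) 1) $ (face Lo (map_ivl \<phi>\<^sub>l q), face Lo (map_ivl \<phi>\<^sub>r p)) = \<Gamma>"
      if "lo p < hi p" "lo q < hi q" for p q
    proof -
      from that obtain i j k m where
        "lo p = a i" "hi p = b j" "lo q = a k" "hi q = b m" "i < u" "j < v" "k < u" "m < v"
        unfolding less by blast
      then have "Gamma4 \<phi>\<^sub>l \<phi>\<^sub>r r (lo p) (hi p) (lo q) (hi q) = \<Gamma>" using const_Gamma by simp
      then show ?thesis by (simp add: Gamma4_def coeff_def bas_def tens_axis aut)
    qed
  qed (use r_aut aut r_induces thin in \<open>simp_all\<close>)
  note square = square_coeffs[OF comm strict r_square]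
  \<comment> \<open>The square condition at \<open>Lo\<close> makes \<open>\<rho>\<^sub>a\<close>
    the inverse of \<alpha>; at \<open>Hi\<close> it gives \<open>\<rho>\<^sub>b\<close>, because
    \<epsilon> is its own inverse. The right coefficients thus take the form required by
    \<open>braid_coeff\<close>, with \<open>\<rho>\<^sub>a\<close> as third argument.\<close>
  have ab: "\<alpha> * \<rho>\<^sub>a = 1" using square(1)[of Lo] by (simp add: mult.commute)
  have "\<epsilon> * \<epsilon> = 1" using eps(1) by auto
  moreover have "\<rho>\<^sub>b * (\<epsilon> * \<alpha>) = 1" using square(1)[of Hi] by simp
  ultimately have rho_b: "\<rho>\<^sub>b = \<epsilon> * \<rho>\<^sub>a" using ab by algebra
  have cc: "cell_coeff (edge_coeff \<alpha> (\<epsilon> * \<alpha>) \<beta>\<^sub>a \<beta>\<^sub>b)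
      (edge_coeff \<rho>\<^sub>a \<rho>\<^sub>b (?br (a 0) (a 0) (b 0)) (?br (b 0) (a 0) (b 0))) \<Gamma> =
      braid_coeff \<epsilon> \<alpha> \<rho>\<^sub>a \<beta>\<^sub>a \<beta>\<^sub>b \<Gamma>"
    using square(2)[of Lo] square(2)[of Hi] by (simp add: braid_coeff_def rho_b)
  have "braid_solution r \<longleftrightarrow> cell_braid_family \<epsilon> \<alpha> \<beta>\<^sub>a \<beta>\<^sub>b \<Gamma>"
  proof
    assume "braid_solution r"
    note eq = braid_solutionD[OF comm strict this, unfolded cc]
    show "cell_braid_family \<epsilon> \<alpha> \<beta>\<^sub>a \<beta>\<^sub>b \<Gamma>"
      by (rule family_if_equations[OF ab eps(1) cell_braid_equations(1)[OF ab eq]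
            cell_braid_equations(2)[OF ab eq] cell_braid_equations(3)[OF ab eq]])
  next
    assume "cell_braid_family \<epsilon> \<alpha> \<beta>\<^sub>a \<beta>\<^sub>b \<Gamma>"
    then show "braid_solution r"
      using cell_braid_if_family[OF ab] by (intro braid_solutionI[OF comm comparable]) (simp add: cc cell_braid_def)
  qed
  then show ?thesis
    using r_induces r_square by (simp only: cell_braid_family_def simp_thms)
qed

end
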